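(* Let $K$ be a field, let $n\ge 3$, let $C$ be the cycle of length $n$ on the vertex set $[n]=\{1,\dots,n\}$, let $S=K[x_1,\dots,x_n,y_1,\dots,y_n]$, and let $I_C\subset S$ be the binomial edge ideal of $C$. Then the Hilbert series of $S/I_C$ is $$H(S/I_C,t)=\frac{(1+t)^{n-1}-t^{2}(1+t)^{n-1}+(n-1)t^{n}+t^{n+1}}{(1-t)^{n+1}}.$$ In particular, the multiplicity of $S/I_C$ is $e(S/I_C)=n$.
   Context: The cycle $C$ has edges $\{1,2\},\{2,3\},\dots,\{n-1,n\},\{1,n\}$. Its binomial edge ideal $I_C\subset S$ is the ideal generated by all $x_iy_j-x_jy_i$ with $i<j$ and $\{i,j\}$ an edge of $C$. The ring $S$ has the standard grading (all variables in degree 1). For a finitely generated graded $S$-module $N$, $H(N,t)=\sum_i \dim_K(N_i)\,t^i$ is its Hilbert series; $e(N)$ denotes its multiplicity, i.e. if $H(N,t)=h(t)/(1-t)^{d}$ with $d=\dim N$, then $e(N)=h(1)$. *)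

theory Defs
  imports
    "HOL-Algebra.QuotRing"
    "HOL-Algebra.Embedded_Algebras"
    "HOL-Library.Poly_Mapping"
    "HOL-Library.Extended_Nat"
    "HOL-Computational_Algebra.Polynomial_FPS"
begin

section \<open>Polynomial rings\<close>

text \<open>
  Monomials are finitely supported exponent vectors, polynomials are finitely supported maps from
  monomials to coefficients; multiplication on the latter type is convolution.
\<close>

type_synonym ('v, 'k) mpoly = "('v \<Rightarrow>\<^sub>0 nat) \<Rightarrow>\<^sub>0 'k"

definition mpoly_var :: "'v \<Rightarrow> ('v, 'k::field) mpoly" where
  "mpoly_var v = Poly_Mapping.single (Poly_Mapping.single v 1) 1"

definition mpoly_const :: "'k::field \<Rightarrow> ('v, 'k) mpoly" where
  "mpoly_const c = Poly_Mapping.single 0 c"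

definition mpoly_ring :: "'v set \<Rightarrow> ('v, 'k::field) mpoly ring" where
  "mpoly_ring V =
     \<lparr>carrier = {p. \<forall>m\<in>Poly_Mapping.keys p. Poly_Mapping.keys m \<subseteq> V},
      monoid.mult = (*), one = 1, zero = 0, add = (+)\<rparr>"

definition mono_degree :: "('v \<Rightarrow>\<^sub>0 nat) \<Rightarrow> nat" where
  "mono_degree m = (\<Sum>v\<in>Poly_Mapping.keys m. Poly_Mapping.lookup m v)"

text \<open>The graded piece in degree \<open>i\<close> for the standard grading.\<close>

definition mpoly_component :: "'v set \<Rightarrow> nat \<Rightarrow> ('v, 'k::field) mpoly set" where
  "mpoly_component V i =
     {p \<in> carrier (mpoly_ring V). \<forall>m\<in>Poly_Mapping.keys p. mono_degree m = i}"

lemma mpoly_ring_cring: "cring (mpoly_ring V :: ('v, 'k::field) mpoly ring)"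
proof -
  let ?R = "mpoly_ring V :: ('v, 'k) mpoly ring"
  have add_closed: "x + y \<in> carrier ?R" if "x \<in> carrier ?R" "y \<in> carrier ?R" for x y
    using that Poly_Mapping.keys_add[of x y] by (fastforce simp: mpoly_ring_def)
  have keys_plus: "Poly_Mapping.keys (m + m') \<subseteq> V"
    if "Poly_Mapping.keys m \<subseteq> V" "Poly_Mapping.keys m' \<subseteq> V" for m m' :: "'v \<Rightarrow>\<^sub>0 nat"
    using that Poly_Mapping.keys_add[of m m'] by blast
  have mult_closed: "x * y \<in> carrier ?R" if "x \<in> carrier ?R" "y \<in> carrier ?R" for x y
  proof -
    have "Poly_Mapping.keys m \<subseteq> V" if m: "m \<in> Poly_Mapping.keys (x * y)" for m
    proof -
      obtain a b where "m = a + b" "a \<in> Poly_Mapping.keys x" "b \<in> Poly_Mapping.keys y"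
        using m Poly_Mapping.keys_mult[of x y] by blast
      then show ?thesis
        using keys_plus \<open>x \<in> carrier ?R\<close> \<open>y \<in> carrier ?R\<close> by (auto simp: mpoly_ring_def)
    qed
    then show ?thesis by (simp add: mpoly_ring_def)
  qed
  have simps: "x \<oplus>\<^bsub>?R\<^esub> y = x + y" "x \<otimes>\<^bsub>?R\<^esub> y = x * y" "\<zero>\<^bsub>?R\<^esub> = 0" "\<one>\<^bsub>?R\<^esub> = 1" for x y
    by (simp_all add: mpoly_ring_def)
  have closed: "0 \<in> carrier ?R" "1 \<in> carrier ?R" "\<And>x. x \<in> carrier ?R \<Longrightarrow> - x \<in> carrier ?R"
    by (simp_all add: mpoly_ring_def)
  show ?thesis
  proof (rule cringI)
    show "abelian_group ?R"
    proof (rule abelian_groupI)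
      fix x assume "x \<in> carrier ?R"
      then show "\<exists>y\<in>carrier ?R. y \<oplus>\<^bsub>?R\<^esub> x = \<zero>\<^bsub>?R\<^esub>"
        by (intro bexI[of _ "- x"]) (simp_all add: simps closed)
    qed (simp_all add: simps closed add_closed add_ac)
    show "comm_monoid ?R"
      by (rule comm_monoidI) (simp_all add: simps closed mult_closed mult_ac)
  qed (simp_all add: simps distrib_right)
qed

section \<open>Hilbert series, dimension and multiplicity of a standard graded quotient\<close>

text \<open>
  For a homogeneous proper ideal \<open>I\<close> of \<open>S = mpoly_ring V\<close> with \<open>V\<close> finite, the degree \<open>i\<close> piece of
  \<open>S / I\<close> is the image of the degree \<open>i\<close> piece of \<open>S\<close>. The field of scalars, needed for the
  dimension, is the image of the constants in \<open>S / I\<close>.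
\<close>

definition quot_scalars :: "'v set \<Rightarrow> ('v, 'k::field) mpoly set \<Rightarrow> ('v, 'k) mpoly set set" where
  "quot_scalars V I = (\<lambda>c. I +>\<^bsub>mpoly_ring V\<^esub> mpoly_const c) ` UNIV"

definition quot_component ::
    "'v set \<Rightarrow> ('v, 'k::field) mpoly set \<Rightarrow> nat \<Rightarrow> ('v, 'k) mpoly set set" where
  "quot_component V I i = (\<lambda>p. I +>\<^bsub>mpoly_ring V\<^esub> p) ` mpoly_component V i"

definition hilbert_function :: "'v set \<Rightarrow> ('v, 'k::field) mpoly set \<Rightarrow> nat \<Rightarrow> nat" where
  "hilbert_function V I i =
     ring.dim (mpoly_ring V Quot I) (quot_scalars V I) (quot_component V I i)"

definition hilbert_series :: "'v set \<Rightarrow> ('v, 'k::field) mpoly set \<Rightarrow> rat fps" where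
  "hilbert_series V I = Abs_fps (\<lambda>i. of_nat (hilbert_function V I i))"

definition krull_dim :: "('a, 'b) ring_scheme \<Rightarrow> enat" where
  "krull_dim R =
     Sup {enat l | l. \<exists>P. (\<forall>i\<le>l. primeideal (P i) R) \<and> (\<forall>i<l. P i \<subset> P (Suc i))}"

text \<open>
  The dimension of the module \<open>S / I\<close> is the Krull dimension of the ring \<open>S / I\<close>, as the annihilator
  of \<open>S / I\<close> is \<open>I\<close>.
\<close>

definition graded_multiplicity :: "'v set \<Rightarrow> ('v, 'k::field) mpoly set \<Rightarrow> rat" where
  "graded_multiplicity V I =
     (THE e. \<exists>h d. krull_dim (mpoly_ring V Quot I) = enat d \<and>
                   hilbert_series V I = fps_of_poly h / (1 - fps_X) ^ d \<and>
                   e = poly h 1)"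

section \<open>Binomial edge ideals\<close>

datatype bvar = X nat | Y nat

definition bvars :: "nat \<Rightarrow> bvar set" where
  "bvars n = X ` {1..n} \<union> Y ` {1..n}"

definition binomial_edge_ideal :: "nat \<Rightarrow> nat set set \<Rightarrow> (bvar, 'k::field) mpoly set" where
  "binomial_edge_ideal n E =
     Idl\<^bsub>mpoly_ring (bvars n)\<^esub>
       {mpoly_var (X i) * mpoly_var (Y j) - mpoly_var (X j) * mpoly_var (Y i) | i j.
          i \<in> {1..n} \<and> j \<in> {1..n} \<and> i < j \<and> {i, j} \<in> E}"

definition cycle_edges :: "nat \<Rightarrow> nat set set" where
  "cycle_edges n = {{i, i + 1} | i. 1 \<le> i \<and> i < n} \<union> {{1, n}}"

end

theory Submission
  imports Defs
begin

text \<open>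
  The ideal is generated by differences of monomials, so the dimension of \<open>(S/I)\<^sub>d\<close> is the number of
  classes of monomials of degree \<open>d\<close> under the moves \<open>x\<^sub>i y\<^sub>j \<leftrightarrow> x\<^sub>j y\<^sub>i\<close> along edges. Reading a monomial as
  a configuration of \<open>x\<close>-particles and \<open>y\<close>-holes, site \<open>i\<close> having capacity \<open>c\<^sub>i = deg x\<^sub>i + deg y\<^sub>i\<close>, a
  move lets a particle hop along an edge. Hence \<open>c\<close> is invariant, and two configurations with the same
  \<open>c\<close> are equivalent iff they have equally many particles on every connected component of the
  subgraph induced on the support of \<open>c\<close>. Scanning the cycle once gives a linear recursion for the
  generating function of the number of classes.

  For the dimension, let \<open>P\<^sub>0 \<subset> \<dots> \<subset> P\<^sub>l\<close> be primes containing \<open>I\<close> and choose \<open>f\<^sub>i \<in> P\<^sub>i - P\<^sub>i\<^sub>-\<^sub>1\<close>. The products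
  of powers of the \<open>f\<^sub>i\<close> are linearly independent modulo \<open>P\<^sub>0\<close>, so the sums of the Hilbert function
  grow at least like the \<open>l\<close>-th power of the degree, which forces \<open>l \<le> n + 1\<close>. A chain of length
  \<open>n + 1\<close> starts at the ideal of 2-minors of the generic \<open>2 \<times> n\<close> matrix.
\<close>

section \<open>Counting exclusion configurations on the cycle\<close>

text \<open>Moves only show that there are at most as many dimensions as classes. Conversely, the
  sum of the coefficients over one class is a linear functional that vanishes on the ideal, so
  distinct classes stay independent modulo the ideal, over every field. The cycle has no first
  vertex: a scan that starts at column 1 may start inside a component that also reaches column
  \<open>n\<close>. The degree of the first piece is therefore carried along until the last piece is
  complete. The recursion closes because the generating functions are affine in each carried degree,
  so a constant term and a slope describe them. The multiplicity is defined through the Krull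
  dimension, and a pole of order \<open>n + 1\<close> does not by itself give that dimension. This
  is why chains of primes are treated separately, with the Hilbert series used only as a bound on
  growth.\<close>

definition col_size :: "nat \<times> nat \<Rightarrow> nat" where
  "col_size p = fst p + snd p"

lemma col_size_Pair [simp]: "col_size (a, b) = a + b"
  by (simp add: col_size_def)

text \<open>
  A list of columns (exponents of \<open>x\<^sub>i\<close>, \<open>y\<^sub>i\<close>) is cut at its zero columns, and the \<open>x\<close>-degrees of the
  pieces are recorded. The first and the last piece are adjacent on the cycle and are merged: \<open>r\<close> is
  the \<open>x\<close>-degree of the first piece, \<open>s\<close> that of the piece being read. In \<open>tail_count\<close> and
  \<open>cyc_count\<close> the parameters are the total degrees of these pieces.
\<close>

fun tail_sums :: "nat \<Rightarrow> nat \<Rightarrow> (nat \<times> nat) list \<Rightarrow> nat list" where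
  "tail_sums r s [] = [r + s]"
| "tail_sums r s (p # ps) =
     (if col_size p = 0 then s # tail_sums r 0 ps else tail_sums r (s + fst p) ps)"

fun cyc_sums :: "nat \<Rightarrow> (nat \<times> nat) list \<Rightarrow> nat list" where
  "cyc_sums s [] = [s]"
| "cyc_sums s (p # ps) =
     (if col_size p = 0 then tail_sums s 0 ps else cyc_sums (s + fst p) ps)"

fun tail_count :: "nat \<Rightarrow> nat \<Rightarrow> nat list \<Rightarrow> nat" where
  "tail_count r s [] = r + s + 1"
| "tail_count r s (c # cs) =
     (if c = 0 then (s + 1) * tail_count r 0 cs else tail_count r (s + c) cs)"

fun cyc_count :: "nat \<Rightarrow> nat list \<Rightarrow> nat" where
  "cyc_count s [] = s + 1"
| "cyc_count s (c # cs) =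
     (if c = 0 then tail_count s 0 cs else cyc_count (s + c) cs)"

text \<open>The pieces read so far can have any x-degree up to their total degrees \<open>r\<close>
  and \<open>s\<close>. A nonempty column of size \<open>c\<close> widens the range
  \<open>{..s}\<close> to \<open>{..s + c}\<close>; a zero column closes the piece, with
  \<open>s + 1\<close> independent choices; at the end the first and the last range merge into one
  with \<open>r + s + 1\<close> values. Letting \<open>x\<close> and \<open>y\<close> vary below
  bounds makes the set stable under the induction.\<close>

lemma card_tail_sums:
  "finite {tail_sums x y ps | x y ps. x \<le> r \<and> y \<le> s \<and> map col_size ps = cs} \<and>
   card {tail_sums x y ps | x y ps. x \<le> r \<and> y \<le> s \<and> map col_size ps = cs} = tail_count r s cs"
  (is "finite (?T s cs) \<and> _")
proof (induction cs arbitrary: s)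
  case Nil
  have "?T s [] = (\<lambda>z. [z]) ` {..r + s}"
  proof (intro equalityI subsetI)
    fix v assume "v \<in> (\<lambda>z. [z]) ` {..r + s}"
    then obtain z where z: "v = [z]" "z \<le> r + s" by auto
    then have "v = tail_sums (min z r) (z - min z r) []" by simp
    moreover have "min z r \<le> r" "z - min z r \<le> s" using z by auto
    ultimately show "v \<in> ?T s []" by (intro CollectI exI[of _ "min z r"] exI[of _ "z - min z r"] exI[of _ "[]"]) simp
  qed auto
  then show ?case by (simp add: card_image inj_on_def)
next
  case (Cons c cs)
  show ?case
  proof (cases "c = 0")
    case True
    have "?T s (c # cs) = (\<lambda>(y, l). y # l) ` ({..s} \<times> ?T 0 cs)"
    proof (intro equalityI subsetI)
      fix v assume "v \<in> ?T s (c # cs)"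
      then obtain x y ps where v: "v = tail_sums x y ps" "x \<le> r" "y \<le> s" "map col_size ps = c # cs"
        by (elim CollectE exE conjE) (rule that)
      then obtain p ps' where "ps = p # ps'" "col_size p = 0" "map col_size ps' = cs"
        using True by auto
      then show "v \<in> (\<lambda>(y, l). y # l) ` ({..s} \<times> ?T 0 cs)" using v by force
    next
      fix v assume "v \<in> (\<lambda>(y, l). y # l) ` ({..s} \<times> ?T 0 cs)"
      then obtain x y ps where v: "v = y # tail_sums x 0 ps" "x \<le> r" "y \<le> s" "map col_size ps = cs"
        by auto
      then have "v = tail_sums x y ((0,0) # ps)" "map col_size ((0,0) # ps) = c # cs"
        using True by simp_all
      then show "v \<in> ?T s (c # cs)" using v(2,3) unfolding mem_Collect_eq by metis
    qed
    moreover have "inj_on (\<lambda>(y, l). y # l) ({..s} \<times> ?T 0 cs)" by (auto simp: inj_on_def)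
    ultimately show ?thesis using Cons.IH[of 0] True
      by (simp add: card_image card_cartesian_product)
  next
    case False
    have "?T s (c # cs) = ?T (s + c) cs"
    proof (intro equalityI subsetI)
      fix v assume "v \<in> ?T s (c # cs)"
      then obtain x y ps where v: "v = tail_sums x y ps" "x \<le> r" "y \<le> s" "map col_size ps = c # cs"
        by (elim CollectE exE conjE) (rule that)
      then obtain p ps' where "ps = p # ps'" "col_size p = c" "map col_size ps' = cs" by auto
      then have "v = tail_sums x (y + fst p) ps'" "y + fst p \<le> s + c" "map col_size ps' = cs"
        using v False by (auto simp: col_size_def)
      then show "v \<in> ?T (s + c) cs" using v(2) by blast
    next
      fix v assume "v \<in> ?T (s + c) cs"
      then obtain x y ps where v: "v = tail_sums x y ps" "x \<le> r" "y \<le> s + c" "map col_size ps = cs"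
        by (elim CollectE exE conjE) (rule that)
      \<comment> \<open>As much of \<open>y\<close> as fits goes into the new column; the remainder
        is then at most \<open>s\<close>.\<close>
      let ?p = "(min y c, c - min y c)"
      have "v = tail_sums x (y - min y c) (?p # ps)" "y - min y c \<le> s" "map col_size (?p # ps) = c # cs"
        using v False by auto
      then show "v \<in> ?T s (c # cs)" using v(2) unfolding mem_Collect_eq by metis
    qed
    then show ?thesis using Cons.IH[of "s + c"] False by simp
  qed
qed

text \<open>The first zero column hands the range of the first piece over to
  \<open>tail_sums\<close>. If there is none, the whole cycle is a single component with
  \<open>s + 1\<close> values.\<close>

lemma card_cyc_sums:
  "finite {cyc_sums x ps | x ps. x \<le> s \<and> map col_size ps = cs} \<and>
   card {cyc_sums x ps | x ps. x \<le> s \<and> map col_size ps = cs} = cyc_count s cs"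
  (is "finite (?T s cs) \<and> _")
proof (induction cs arbitrary: s)
  case Nil
  have "?T s [] = (\<lambda>z. [z]) ` {..s}" by auto
  then show ?case by (simp add: card_image inj_on_def)
next
  case (Cons c cs)
  show ?case
  proof (cases "c = 0")
    case True
    have "?T s (c # cs) = {tail_sums x y ps | x y ps. x \<le> s \<and> y \<le> 0 \<and> map col_size ps = cs}"
      (is "_ = ?U")
    proof (intro equalityI subsetI)
      fix v assume "v \<in> ?T s (c # cs)"
      then obtain x ps where v: "v = cyc_sums x ps" "x \<le> s" "map col_size ps = c # cs"
        by (elim CollectE exE conjE) (rule that)
      then obtain p ps' where "ps = p # ps'" "col_size p = 0" "map col_size ps' = cs"
        using True by auto
      then show "v \<in> ?U" using v by force
    next
      fix v assume "v \<in> ?U"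
      then obtain x ps where v: "v = tail_sums x 0 ps" "x \<le> s" "map col_size ps = cs"
        by auto
      then have "v = cyc_sums x ((0,0) # ps)" "map col_size ((0,0) # ps) = c # cs"
        using True by simp_all
      then show "v \<in> ?T s (c # cs)" using v(2) unfolding mem_Collect_eq by metis
    qed
    then show ?thesis using card_tail_sums[of s 0 cs] True by simp
  next
    case False
    have "?T s (c # cs) = ?T (s + c) cs"
    proof (intro equalityI subsetI)
      fix v assume "v \<in> ?T s (c # cs)"
      then obtain y ps where v: "v = cyc_sums y ps" "y \<le> s" "map col_size ps = c # cs"
        by (elim CollectE exE conjE) (rule that)
      then obtain p ps' where "ps = p # ps'" "col_size p = c" "map col_size ps' = cs" by auto
      then have "v = cyc_sums (y + fst p) ps'" "y + fst p \<le> s + c" "map col_size ps' = cs"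
        using v False by (auto simp: col_size_def)
      then show "v \<in> ?T (s + c) cs" using v(2) by blast
    next
      fix v assume "v \<in> ?T (s + c) cs"
      then obtain y ps where v: "v = cyc_sums y ps" "y \<le> s + c" "map col_size ps = cs"
        by (elim CollectE exE conjE) (rule that)
      let ?p = "(min y c, c - min y c)"
      have "v = cyc_sums (y - min y c) (?p # ps)" "y - min y c \<le> s" "map col_size (?p # ps) = c # cs"
        using v False by auto
      then show "v \<in> ?T s (c # cs)" unfolding mem_Collect_eq by metis
    qed
    then show ?thesis using Cons.IH[of "s + c"] False by simp
  qed
qed

section \<open>Generating functions over lists of column sizes\<close>

definition compositions :: "nat \<Rightarrow> nat \<Rightarrow> nat list set" where
  "compositions n d = {cs. length cs = n \<and> sum_list cs = d}"

lemma finite_compositions: "finite (compositions n d)"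
proof (rule finite_subset)
  show "compositions n d \<subseteq> {cs. set cs \<subseteq> {..d} \<and> length cs = n}"
    by (auto simp: compositions_def intro: member_le_sum_list)
qed (simp add: finite_lists_length_eq)

lemma compositions_0: "compositions 0 d = (if d = 0 then {[]} else {})"
  by (auto simp: compositions_def)

definition list_gf :: "nat \<Rightarrow> (nat list \<Rightarrow> nat) \<Rightarrow> rat fps" where
  "list_gf n w = Abs_fps (\<lambda>d. of_nat (\<Sum>cs\<in>compositions n d. w cs))"

lemma list_gf_0: "list_gf 0 w = of_nat (w [])"
  by (rule fps_ext) (simp add: list_gf_def compositions_0 fps_of_nat[symmetric])

lemma list_gf_scale: "list_gf n (\<lambda>cs. a * w cs) = of_nat a * list_gf n w"
  by (rule fps_ext) (simp add: list_gf_def fps_of_nat[symmetric] sum_distrib_left)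

lemma sum_compositions_Suc:
  "(\<Sum>cs\<in>compositions (Suc n) d. w cs) = (\<Sum>k=0..d. \<Sum>cs\<in>compositions n (d - k). w (k # cs))"
  for w :: "nat list \<Rightarrow> nat"
proof -
  have "(\<Sum>k=0..d. \<Sum>cs\<in>compositions n (d - k). w (k # cs)) =
        (\<Sum>(k, cs)\<in>(SIGMA k:{0..d}. compositions n (d - k)). w (k # cs))"
    by (rule sum.Sigma) (auto simp: finite_compositions)
  also have "\<dots> = (\<Sum>cs\<in>compositions (Suc n) d. w cs)"
    by (rule sum.reindex_bij_witness[of _ "\<lambda>cs. (hd cs, tl cs)" "\<lambda>(k, cs). k # cs"])
       (auto simp: compositions_def length_Suc_conv)
  finally show ?thesis ..
qed

text \<open>The weight of the empty first column is treated separately; a nonempty column of size \<open>k\<close>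
  moves the parameter \<open>s\<close> to \<open>s + k\<close>, and \<open>t/(1-t)\<close>, \<open>t/(1-t)^2\<close> are the generating functions of
  \<open>1\<close> and of \<open>k\<close> over \<open>k > 0\<close>.\<close>

lemma list_gf_Suc:
  fixes w :: "nat \<Rightarrow> nat list \<Rightarrow> nat"
  assumes zero: "\<And>cs. w s (0 # cs) = w0 cs"
    and pos: "\<And>k cs. k > 0 \<Longrightarrow> w s (k # cs) = w (s + k) cs"
    and affine: "\<And>s. list_gf n (w s) = A + of_nat s * B"
  shows "(1 - fps_X)\<^sup>2 * list_gf (Suc n) (w s) =
     (1 - fps_X)\<^sup>2 * list_gf n w0 + fps_X * (1 - fps_X) * (A + of_nat s * B) + fps_X * B"
proof -
  include fps_syntax
  define U :: "rat fps" where "U = Abs_fps (\<lambda>k. if k = 0 then 0 else 1)"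
  define W :: "rat fps" where "W = Abs_fps of_nat"
  have U: "(1 - fps_X) * U = fps_X"
    by (rule fps_ext) (simp add: U_def left_diff_distrib)
  have "(1 - fps_X) * W = U"
    by (rule fps_ext) (auto simp: U_def W_def left_diff_distrib of_nat_diff)
  with U have W: "(1 - fps_X)\<^sup>2 * W = fps_X" by (metis mult.assoc power2_eq_square)
  have eq: "list_gf (Suc n) (w s) = list_gf n w0 + U * (A + of_nat s * B) + W * B"
  proof (rule fps_ext)
    fix d
    have "list_gf (Suc n) (w s) $ d = (\<Sum>k=0..d. list_gf n (\<lambda>cs. w s (k # cs)) $ (d - k))"
      by (simp add: list_gf_def sum_compositions_Suc)
    also have "\<dots> = list_gf n w0 $ d + (\<Sum>k=Suc 0..d. list_gf n (\<lambda>cs. w s (k # cs)) $ (d - k))"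
      by (simp add: sum.atLeast_Suc_atMost zero)
    also have "(\<Sum>k=Suc 0..d. list_gf n (\<lambda>cs. w s (k # cs)) $ (d - k)) =
        (\<Sum>k=Suc 0..d. U $ k * (A + of_nat s * B) $ (d - k) + W $ k * B $ (d - k))"
    proof (rule sum.cong)
      fix k assume k: "k \<in> {Suc 0..d}"
      then have "list_gf n (\<lambda>cs. w s (k # cs)) = A + of_nat s * B + of_nat k * B"
        using pos[of k] affine[of "s + k"] by (simp add: algebra_simps)
      then show "list_gf n (\<lambda>cs. w s (k # cs)) $ (d - k) =
          U $ k * (A + of_nat s * B) $ (d - k) + W $ k * B $ (d - k)"
        using k by (simp add: U_def W_def fps_of_nat[symmetric])
    qed simp
    also have "\<dots> = (\<Sum>k=0..d. U $ k * (A + of_nat s * B) $ (d - k) + W $ k * B $ (d - k))"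
      by (simp add: sum.atLeast_Suc_atMost[of 0] U_def W_def)
    also have "list_gf n w0 $ d + \<dots> = (list_gf n w0 + U * (A + of_nat s * B) + W * B) $ d"
      by (simp add: fps_mult_nth sum.distrib)
    finally show "list_gf (Suc n) (w s) $ d = (list_gf n w0 + U * (A + of_nat s * B) + W * B) $ d" .
  qed
  have "(1 - fps_X)\<^sup>2 * list_gf (Suc n) (w s) = (1 - fps_X)\<^sup>2 * list_gf n w0
      + (1 - fps_X) * ((1 - fps_X) * U) * (A + of_nat s * B) + ((1 - fps_X)\<^sup>2 * W) * B"
    unfolding eq by (simp add: algebra_simps power2_eq_square)
  then show ?thesis unfolding U W by (simp add: mult.commute)
qed

text \<open>The Hilbert series for the path on \<open>n\<close> vertices: its \<open>n - 1\<close>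
  generators form a complete intersection of quadrics in \<open>2n\<close> variables, and
  \<open>(1 - t^2)^(n-1) / (1 - t)^(2n)\<close> cancels to this quotient.\<close>

definition path_gf :: "nat \<Rightarrow> rat fps" where
  "path_gf n = (1 + fps_X) ^ (n - 1) / (1 - fps_X) ^ (n + 1)"

text \<open>\<open>1 - fps_X\<close> is a unit, so the division is exact and identities of series
  can be checked after clearing denominators.\<close>

lemma fps_div_one_minus_X_iff:
  "f = g / (1 - fps_X) ^ k \<longleftrightarrow> (1 - fps_X) ^ k * f = g" for f g :: "'a::field fps"
proof -
  have "fps_nth ((1 - fps_X) ^ k :: 'a fps) 0 \<noteq> 0" by simp
  then have u: "is_unit ((1 - fps_X) ^ k :: 'a fps)" by simp
  then have "(1 - fps_X) ^ k dvd g" by (rule unit_imp_dvd)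
  moreover have "(1 - fps_X) ^ k \<noteq> (0 :: 'a fps)" using u by auto
  ultimately show ?thesis by auto
qed

lemma mult_path_gf: "(1 - fps_X) ^ (n + 1) * path_gf n = (1 + fps_X) ^ (n - 1)"
  by (subst fps_div_one_minus_X_iff[symmetric]) (simp add: path_gf_def)

lemma one_minus_X_cancel:
  assumes "(1 - fps_X) ^ k * f = (1 - fps_X) ^ k * g"
  shows "f = (g :: 'a::field fps)"
  using assms fps_div_one_minus_X_iff by metis

text \<open>At \<open>n = 0\<close> the two pieces are already merged and the weight
  \<open>r + s + 1\<close> does not have this product form, so the induction begins at
  \<open>n = 1\<close>. From there on the series is affine in \<open>s\<close> with slope
  \<open>1 - fps_X\<close> times its constant term, a shape that \<open>list_gf_Suc\<close>
  reproduces.\<close>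

lemma list_gf_tail_count:
  assumes "n \<ge> 1"
  shows "list_gf n (tail_count r s) =
    path_gf n * (1 + of_nat r * (1 - fps_X)) * (1 + of_nat s * (1 - fps_X))"
  using assms
proof (induction n arbitrary: s rule: dec_induct)
  case base
  have "(1 - fps_X)\<^sup>2 * list_gf (Suc 0) (tail_count r s) =
     (1 - fps_X)\<^sup>2 * list_gf 0 (\<lambda>cs. (s + 1) * tail_count r 0 cs)
       + fps_X * (1 - fps_X) * ((of_nat r + 1) + of_nat s * 1) + fps_X * 1"
    by (rule list_gf_Suc[where w = "tail_count r"]) (auto simp: list_gf_0)
  also have "\<dots> = (1 - fps_X)\<^sup>2 * ((of_nat s + 1) * (of_nat r + 1))
       + fps_X * (1 - fps_X) * ((of_nat r + 1) + of_nat s * 1) + fps_X * 1"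
    by (simp add: list_gf_0 ring_distribs)
  also have "\<dots> = 1 * (1 + of_nat r * (1 - fps_X)) * (1 + of_nat s * (1 - fps_X))"
    by (simp add: power2_eq_square algebra_simps)
  also have "\<dots> = (1 - fps_X)\<^sup>2 * (path_gf 1 * (1 + of_nat r * (1 - fps_X)) * (1 + of_nat s * (1 - fps_X)))"
    using mult_path_gf[of 1] by (simp add: numeral_2_eq_2 flip: mult.assoc)
  finally show ?case by (auto dest: one_minus_X_cancel)
next
  case (step n)
  let ?R = "1 + of_nat r * (1 - fps_X) :: rat fps"
  \<comment> \<open>Appending a vertex to the path multiplies its series by
    \<open>(1 + t) / (1 - t)\<close>.\<close>
  have p1: "(1 - fps_X) * path_gf (Suc n) = (1 + fps_X) * path_gf n"
  proof (rule one_minus_X_cancel[where k = "n + 1"])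
    have "(1 - fps_X) ^ (n + 1) * ((1 - fps_X) * path_gf (Suc n)) = (1 - fps_X) ^ (Suc n + 1) * path_gf (Suc n)"
      by (simp add: mult_ac)
    also have "\<dots> = (1 + fps_X) * (1 + fps_X) ^ (n - 1)"
      using step(1) unfolding mult_path_gf by (cases n) auto
    also have "\<dots> = (1 - fps_X) ^ (n + 1) * ((1 + fps_X) * path_gf n)"
      unfolding mult_path_gf[symmetric] by (simp add: mult_ac)
    finally show "(1 - fps_X) ^ (n + 1) * ((1 - fps_X) * path_gf (Suc n)) =
      (1 - fps_X) ^ (n + 1) * ((1 + fps_X) * path_gf n)" .
  qed
  have "(1 - fps_X)\<^sup>2 * list_gf (Suc n) (tail_count r s) =
     (1 - fps_X)\<^sup>2 * list_gf n (\<lambda>cs. (s + 1) * tail_count r 0 cs)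
       + fps_X * (1 - fps_X) * (path_gf n * ?R + of_nat s * (path_gf n * ?R * (1 - fps_X)))
       + fps_X * (path_gf n * ?R * (1 - fps_X))"
    by (rule list_gf_Suc[where w = "tail_count r"]) (simp_all add: step.IH ring_distribs mult_ac)
  also have "\<dots> = (1 - fps_X) * ((1 + fps_X) * path_gf n) * ?R * (1 + of_nat s * (1 - fps_X))"
  proof -
    have "list_gf n (\<lambda>cs. (s + 1) * tail_count r 0 cs) = (of_nat s + 1) * (path_gf n * ?R)"
      by (subst list_gf_scale) (simp add: step.IH)
    moreover have "(1 - x)\<^sup>2 * ((a + 1) * p) + x * (1 - x) * (p + a * (p * (1 - x))) + x * (p * (1 - x))
        = (1 - x) * ((1 + x) * p) * (1 + a * (1 - x))" for x a p :: "rat fps"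
      by (simp add: power2_eq_square algebra_simps)
    note this[of fps_X "of_nat s" "path_gf n * ?R"]
    ultimately show ?thesis by (simp only: mult_ac)
  qed
  also have "\<dots> = (1 - fps_X)\<^sup>2 * (path_gf (Suc n) * ?R * (1 + of_nat s * (1 - fps_X)))"
    unfolding p1[symmetric] by (simp add: power2_eq_square mult_ac)
  finally show ?case by (rule one_minus_X_cancel)
qed

text \<open>Over \<open>(1 - t)^(n+1)\<close> the first term gives
  \<open>((1 + t) / (1 - t))^n\<close>, the series of a complete intersection of \<open>n\<close>
  quadrics in \<open>2n\<close> variables. The other two terms correct for the generators of the
  cycle not being one.\<close>

definition cyc_num :: "nat \<Rightarrow> rat fps" where
  "cyc_num n = (1 - fps_X) * (1 + fps_X) ^ n + of_nat (n - 1) * fps_X ^ n + fps_X ^ (n + 1)"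

text \<open>Only \<open>s = 0\<close> is wanted in the end, but reading a nonempty column raises
  \<open>s\<close>, so the slope has to be found as well. A zero column opens the cycle into a path
  whose first piece has degree \<open>s\<close>.\<close>

lemma list_gf_cyc_count_aux:
  assumes "n \<ge> 1"
  shows "list_gf n (cyc_count s) = cyc_num n / (1 - fps_X) ^ (n + 1)
    + of_nat s * (((1 - fps_X) * ((1 - fps_X) * (1 + fps_X) ^ (n - 1) + fps_X ^ n)) / (1 - fps_X) ^ (n + 1))"
  using assms
proof (induction n arbitrary: s rule: dec_induct)
  case base
  have A: "(1 - fps_X)\<^sup>2 * (cyc_num 1 / (1 - fps_X) ^ (1 + 1)) = 1"
    using fps_div_one_minus_X_iff[of "cyc_num 1 / (1 - fps_X) ^ 2" "cyc_num 1" 2]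
    by (simp add: cyc_num_def algebra_simps power2_eq_square)
  have B: "(1 - fps_X)\<^sup>2 * ((1 - fps_X) / (1 - fps_X) ^ 2) = (1 - fps_X :: rat fps)"
    by (subst fps_div_one_minus_X_iff[symmetric]) (rule refl)
  have "(1 - fps_X)\<^sup>2 * list_gf (Suc 0) (cyc_count s) =
     (1 - fps_X)\<^sup>2 * list_gf 0 (tail_count s 0)
       + fps_X * (1 - fps_X) * (1 + of_nat s * 1) + fps_X * 1"
    by (rule list_gf_Suc[where w = cyc_count]) (auto simp: list_gf_0)
  also have "\<dots> = (1 - fps_X)\<^sup>2 * (of_nat s + 1)
       + fps_X * (1 - fps_X) * (1 + of_nat s * 1) + fps_X * 1"
    by (simp add: list_gf_0)
  also have "\<dots> = 1 + of_nat s * (1 - fps_X)"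
    by (simp add: power2_eq_square algebra_simps)
  also have "\<dots> = (1 - fps_X)\<^sup>2 * (cyc_num 1 / (1 - fps_X) ^ (1 + 1)) +
      of_nat s * ((1 - fps_X)\<^sup>2 * ((1 - fps_X) / (1 - fps_X) ^ 2))"
    unfolding A B ..
  also have "\<dots> = (1 - fps_X)\<^sup>2 * (cyc_num 1 / (1 - fps_X) ^ (1 + 1) +
      of_nat s * ((1 - fps_X) / (1 - fps_X) ^ 2))"
    by (simp only: distrib_left mult.left_commute)
  finally have "list_gf (Suc 0) (cyc_count s) = cyc_num 1 / (1 - fps_X) ^ (1 + 1) +
      of_nat s * ((1 - fps_X) / (1 - fps_X) ^ 2)"
    by (rule one_minus_X_cancel)
  then show ?case by (simp add: numeral_2_eq_2)
next
  case (step n)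
  define j where "j = (\<lambda>n. (1 - fps_X) * (1 + fps_X) ^ (n - 1) + fps_X ^ n :: rat fps)"
  define d where "d = (1 - fps_X :: rat fps) ^ (n + 1)"
  define A where "A = cyc_num n / (1 - fps_X) ^ (n + 1)"
  define B where "B = (1 - fps_X) * j n / (1 - fps_X) ^ (n + 1)"
  define A' where "A' = cyc_num (Suc n) / (1 - fps_X) ^ (Suc n + 1)"
  define B' where "B' = (1 - fps_X) * j (Suc n) / (1 - fps_X) ^ (Suc n + 1)"
  have dA: "d * A = cyc_num n" and dB: "d * B = (1 - fps_X) * j n"
    unfolding d_def A_def B_def by (subst fps_div_one_minus_X_iff[symmetric], rule refl)+
  have dA': "(1 - fps_X) * d * A' = cyc_num (Suc n)" and dB': "(1 - fps_X) * d * B' = (1 - fps_X) * j (Suc n)"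
  proof -
    have d': "(1 - fps_X) * d = (1 - fps_X) ^ (Suc n + 1)" by (simp add: d_def)
    show "(1 - fps_X) * d * A' = cyc_num (Suc n)" "(1 - fps_X) * d * B' = (1 - fps_X) * j (Suc n)"
      unfolding d' A'_def B'_def by (subst fps_div_one_minus_X_iff[symmetric], rule refl)+
  qed
  have dP: "d * path_gf n = (1 + fps_X) ^ (n - 1)"
    using mult_path_gf[of n] by (simp add: d_def)
  obtain m where m: "n = Suc m" using step(1) by (cases n) auto
  \<comment> \<open>These are the recursions that the count imposes on the two numerators; the
    summand with \<open>(1 + fps_X) ^ (n - 1)\<close> is the path left over when the new column is
    zero.\<close>
  have e': "cyc_num (Suc n) = (1 - fps_X) * (1 + fps_X) ^ (n - 1) + fps_X * cyc_num n + fps_X * j n"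
    by (simp add: cyc_num_def j_def m algebra_simps)
  have j': "j (Suc n) = (1 - fps_X) * (1 + fps_X) ^ (n - 1) + fps_X * j n"
    by (simp add: j_def m algebra_simps)
  have "(1 - fps_X)\<^sup>2 * list_gf (Suc n) (cyc_count s) =
     (1 - fps_X)\<^sup>2 * list_gf n (tail_count s 0)
       + fps_X * (1 - fps_X) * (A + of_nat s * B) + fps_X * B"
    by (rule list_gf_Suc[where w = cyc_count]) (simp_all add: step.IH A_def B_def j_def)
  also have "list_gf n (tail_count s 0) = path_gf n * (1 + of_nat s * (1 - fps_X))"
    using list_gf_tail_count[of n s 0] step(1) by simp
  finally have *: "(1 - fps_X)\<^sup>2 * list_gf (Suc n) (cyc_count s) =
     (1 - fps_X)\<^sup>2 * (path_gf n * (1 + of_nat s * (1 - fps_X)))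
       + fps_X * (1 - fps_X) * (A + of_nat s * B) + fps_X * B" .
  have "d * ((1 - fps_X)\<^sup>2 * list_gf (Suc n) (cyc_count s)) =
     (1 - fps_X)\<^sup>2 * (d * path_gf n) * (1 + of_nat s * (1 - fps_X))
       + fps_X * (1 - fps_X) * (d * A + of_nat s * (d * B)) + fps_X * (d * B)"
    unfolding * by (simp only: distrib_left mult_ac)
  also have "\<dots> = (1 - fps_X) * (cyc_num (Suc n) + of_nat s * ((1 - fps_X) * j (Suc n)))"
  proof -
    \<comment> \<open>With the path term, the numerator and \<open>j n\<close> replaced by unknowns
      \<open>p\<close>, \<open>e\<close>, \<open>q\<close>, a plain polynomial identity
      remains.\<close>
    have "(1 - x)\<^sup>2 * p * (1 + a * (1 - x)) + x * (1 - x) * (e + a * ((1 - x) * q)) + x * ((1 - x) * q)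
        = (1 - x) * (((1 - x) * p + x * e + x * q) + a * ((1 - x) * ((1 - x) * p + x * q)))"
      for x a p e q :: "rat fps"
      by (simp add: power2_eq_square algebra_simps)
    then show ?thesis unfolding dP dA dB e' j' .
  qed
  also have "\<dots> = d * ((1 - fps_X)\<^sup>2 * (A' + of_nat s * B'))"
    unfolding dA'[symmetric] dB'[symmetric] by (simp only: distrib_left mult_ac power2_eq_square)
  finally have "(1 - fps_X) ^ (n + 3) * list_gf (Suc n) (cyc_count s) = (1 - fps_X) ^ (n + 3) * (A' + of_nat s * B')"
    unfolding d_def by (simp add: power_add power2_eq_square power3_eq_cube mult_ac)
  then show ?case unfolding A'_def B'_def j_def by (rule one_minus_X_cancel)
qed

lemma list_gf_cyc_count:
  assumes "n \<ge> 1"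
  shows "list_gf n (cyc_count 0) = ((1 + fps_X) ^ (n - 1) - fps_X ^ 2 * (1 + fps_X) ^ (n - 1)
              + of_nat (n - 1) * fps_X ^ n + fps_X ^ (n + 1))
           / (1 - fps_X) ^ (n + 1)"
proof -
  obtain m where m: "n = Suc m" using assms by (cases n) auto
  have "cyc_num n = (1 + fps_X) ^ (n - 1) - fps_X ^ 2 * (1 + fps_X) ^ (n - 1)
              + of_nat (n - 1) * fps_X ^ n + fps_X ^ (n + 1)"
    by (simp add: cyc_num_def m algebra_simps power2_eq_square)
  then show ?thesis using list_gf_cyc_count_aux[OF assms, of 0] by simp
qed

section \<open>Quotients spanned by classes of monomials\<close>

abbreviation monomials :: "'v set \<Rightarrow> ('v \<Rightarrow>\<^sub>0 nat) set" where
  "monomials V \<equiv> {m. Poly_Mapping.keys m \<subseteq> V}"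

abbreviation monom_of :: "('v \<Rightarrow>\<^sub>0 nat) \<Rightarrow> ('v, 'k::field) mpoly" where
  "monom_of m \<equiv> Poly_Mapping.single m 1"

section \<open>Arithmetic and ideals of the polynomial ring\<close>

lemma mpoly_ring_simps [simp]:
  "monoid.mult (mpoly_ring V) = (*)" "one (mpoly_ring V) = 1"
  "zero (mpoly_ring V) = 0" "add (mpoly_ring V) = (+)"
  by (simp_all add: mpoly_ring_def)

lemma carrier_mpoly_ring: "p \<in> carrier (mpoly_ring V) \<longleftrightarrow> Poly_Mapping.keys p \<subseteq> monomials V"
  by (auto simp: mpoly_ring_def)

lemma mpoly_ring_ring: "ring (mpoly_ring V :: ('v, 'k::field) mpoly ring)"
  using mpoly_ring_cring by (rule cring.axioms(1))

lemma mpoly_ring_a_inv: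
  assumes "p \<in> carrier (mpoly_ring V)"
  shows "a_inv (mpoly_ring V) p = - p"
proof -
  interpret ring "mpoly_ring V :: ('a, 'b) mpoly ring" by (rule mpoly_ring_ring)
  have "- p \<in> carrier (mpoly_ring V)" using assms by (simp add: carrier_mpoly_ring)
  then show ?thesis using minus_equality[of "- p" p] assms by simp
qed

lemma mpoly_ring_a_minus:
  assumes "p \<in> carrier (mpoly_ring V)" "q \<in> carrier (mpoly_ring V)"
  shows "a_minus (mpoly_ring V) p q = p - q"
  using assms by (simp add: a_minus_def mpoly_ring_a_inv)

lemma keys_plus_nat:
  "Poly_Mapping.keys (m + m' :: 'v \<Rightarrow>\<^sub>0 nat) = Poly_Mapping.keys m \<union> Poly_Mapping.keys m'"
  by (auto simp: in_keys_iff lookup_add)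

lemma carrier_closed:
  "0 \<in> carrier (mpoly_ring V :: ('v, 'k) mpoly ring)" "1 \<in> carrier (mpoly_ring V :: ('v, 'k) mpoly ring)"
  "p \<in> carrier (mpoly_ring V) \<Longrightarrow> - p \<in> carrier (mpoly_ring V)"
  "p \<in> carrier (mpoly_ring V) \<Longrightarrow> q \<in> carrier (mpoly_ring V) \<Longrightarrow> p + q \<in> carrier (mpoly_ring V)"
  "p \<in> carrier (mpoly_ring V) \<Longrightarrow> q \<in> carrier (mpoly_ring V) \<Longrightarrow> p - q \<in> carrier (mpoly_ring V)"
  "p \<in> carrier (mpoly_ring V) \<Longrightarrow> q \<in> carrier (mpoly_ring V) \<Longrightarrow> p * q \<in> carrier (mpoly_ring V)"
  "m \<in> monomials V \<Longrightarrow> Poly_Mapping.single m c \<in> carrier (mpoly_ring V)"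
  for p q :: "('v, 'k::field) mpoly"
proof -
  interpret ring "mpoly_ring V :: ('v, 'k) mpoly ring" by (rule mpoly_ring_ring)
  show "0 \<in> carrier (mpoly_ring V :: ('v, 'k) mpoly ring)" "1 \<in> carrier (mpoly_ring V :: ('v, 'k) mpoly ring)"
    using zero_closed one_closed by auto
  show neg: "- p \<in> carrier (mpoly_ring V)" if "p \<in> carrier (mpoly_ring V)" for p :: "('v, 'k) mpoly"
    using that by (simp add: carrier_mpoly_ring)
  show add: "p + q \<in> carrier (mpoly_ring V)"
    if "p \<in> carrier (mpoly_ring V)" "q \<in> carrier (mpoly_ring V)" for p q :: "('v, 'k) mpoly"
    using add.m_closed[OF that] by simp
  show "p - q \<in> carrier (mpoly_ring V)"
    if "p \<in> carrier (mpoly_ring V)" "q \<in> carrier (mpoly_ring V)" for p q :: "('v, 'k) mpoly"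
    using add[OF that(1) neg[OF that(2)]] by simp
  show "p * q \<in> carrier (mpoly_ring V)"
    if "p \<in> carrier (mpoly_ring V)" "q \<in> carrier (mpoly_ring V)" for p q :: "('v, 'k) mpoly"
    using m_closed[OF that] by simp
  show "Poly_Mapping.single m c \<in> carrier (mpoly_ring V)" if "m \<in> monomials V"
    using that by (auto simp: carrier_mpoly_ring)
qed

lemma carrier_sum:
  "(\<And>i. i \<in> A \<Longrightarrow> f i \<in> carrier (mpoly_ring V)) \<Longrightarrow> (\<Sum>i\<in>A. f i) \<in> carrier (mpoly_ring V)"
  for f :: "'i \<Rightarrow> ('v, 'k::field) mpoly"
  by (induction A rule: infinite_finite_induct) (auto intro: carrier_closed)

lemma ideal_mpoly_ringI:
  fixes J :: "('v, 'k::field) mpoly set"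
  assumes "J \<subseteq> carrier (mpoly_ring V)" "0 \<in> J"
    and "\<And>p q. p \<in> J \<Longrightarrow> q \<in> J \<Longrightarrow> p + q \<in> J"
    and "\<And>p q. p \<in> J \<Longrightarrow> q \<in> carrier (mpoly_ring V) \<Longrightarrow> q * p \<in> J"
  shows "ideal J (mpoly_ring V)"
proof (rule idealI)
  interpret ring "mpoly_ring V :: ('v, 'k) mpoly ring" by (rule mpoly_ring_ring)
  have "- p \<in> J" if "p \<in> J" for p
    using assms(4)[OF that, of "- 1"] by (simp add: carrier_closed)
  then show "subgroup J (add_monoid (mpoly_ring V))"
    using assms by (intro add.subgroupI) (auto simp: mpoly_ring_a_inv subset_iff simp flip: a_inv_def)
qed (use assms in \<open>auto simp: mpoly_ring_ring mult.commute\<close>)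

lemma ideal_mpoly_ringD:
  fixes J :: "('v, 'k::field) mpoly set"
  assumes "ideal J (mpoly_ring V)"
  shows "J \<subseteq> carrier (mpoly_ring V)" "0 \<in> J"
    and "\<And>p q. p \<in> J \<Longrightarrow> q \<in> J \<Longrightarrow> p + q \<in> J"
    and "\<And>p q. p \<in> J \<Longrightarrow> q \<in> J \<Longrightarrow> p - q \<in> J"
    and "\<And>p q. p \<in> J \<Longrightarrow> q \<in> carrier (mpoly_ring V) \<Longrightarrow> q * p \<in> J"
proof -
  interpret ideal J "mpoly_ring V :: ('v, 'k) mpoly ring" by fact
  show sub: "J \<subseteq> carrier (mpoly_ring V)" by (rule a_subset)
  show "0 \<in> J" using additive_subgroup.zero_closed[OF is_additive_subgroup] by simp
  show add: "p + q \<in> J" if "p \<in> J" "q \<in> J" for p q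
    using additive_subgroup.a_closed[OF is_additive_subgroup that] by simp
  show mult: "q * p \<in> J" if "p \<in> J" "q \<in> carrier (mpoly_ring V)" for p q
    using I_l_closed[OF that] by simp
  show "p - q \<in> J" if "p \<in> J" "q \<in> J" for p q
    using add[OF that(1) mult[OF that(2), of "- 1"]] by (simp add: carrier_closed)
qed

lemma ideal_mpoly_ring_sum:
  fixes J :: "('v, 'k::field) mpoly set"
  assumes "ideal J (mpoly_ring V)" "\<And>i. i \<in> A \<Longrightarrow> f i \<in> J"
  shows "(\<Sum>i\<in>A. f i) \<in> J"
  using assms(2)
  by (induction A rule: infinite_finite_induct) (auto intro: ideal_mpoly_ringD[OF assms(1)])

text \<open>One construction for linear functionals, for evaluation homomorphisms and for the degree
  of a monomial. The coefficient is an argument of \<open>f\<close> so that the values may lie in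
  any commutative monoid.\<close>

definition extend_sum :: "('m \<Rightarrow> 'k::zero \<Rightarrow> 'b::comm_monoid_add) \<Rightarrow> ('m \<Rightarrow>\<^sub>0 'k) \<Rightarrow> 'b" where
  "extend_sum f p = (\<Sum>m\<in>Poly_Mapping.keys p. f m (Poly_Mapping.lookup p m))"

lemma extend_sum_superset:
  assumes "\<And>m. f m 0 = 0" "finite A" "Poly_Mapping.keys p \<subseteq> A"
  shows "extend_sum f p = (\<Sum>m\<in>A. f m (Poly_Mapping.lookup p m))"
  unfolding extend_sum_def using assms
  by (intro sum.mono_neutral_left) (auto simp: in_keys_iff)

lemma extend_sum_add:
  assumes "\<And>m. f m 0 = 0" "\<And>m a b. f m (a + b) = f m a + f m b"
  shows "extend_sum f (p + q) = extend_sum f p + extend_sum f q"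
proof -
  let ?A = "Poly_Mapping.keys p \<union> Poly_Mapping.keys q"
  have "extend_sum f r = (\<Sum>m\<in>?A. f m (Poly_Mapping.lookup r m))" if "Poly_Mapping.keys r \<subseteq> ?A" for r
    using that by (intro extend_sum_superset assms(1)) auto
  from this[of p] this[of q] this[of "p + q"] show ?thesis
    using keys_add[of p q] by (simp add: lookup_add assms(2) sum.distrib)
qed

lemma extend_sum_zero [simp]: "extend_sum f 0 = 0"
  by (simp add: extend_sum_def)

lemma extend_sum_single: "f m 0 = 0 \<Longrightarrow> extend_sum f (Poly_Mapping.single m a) = f m a"
  by (cases "a = 0") (simp_all add: extend_sum_def)

lemma extend_sum_sum:
  assumes "\<And>m. f m 0 = 0" "\<And>m a b. f m (a + b) = f m a + f m b"
  shows "extend_sum f (\<Sum>i\<in>A. g i) = (\<Sum>i\<in>A. extend_sum f (g i))"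
  by (induction A rule: infinite_finite_induct) (simp_all add: extend_sum_add[OF assms])

lemma poly_mapping_sum_single:
  "p = (\<Sum>m\<in>Poly_Mapping.keys p. Poly_Mapping.single m (Poly_Mapping.lookup p m))"
  by (rule poly_mapping_eqI) (auto simp: lookup_sum lookup_single when_def in_keys_iff sum.delta)

definition lin :: "('m \<Rightarrow> 'k) \<Rightarrow> ('m \<Rightarrow>\<^sub>0 'k::field) \<Rightarrow> 'k" where
  "lin f = extend_sum (\<lambda>m a. a * f m)"

lemma lin_simps:
  "lin f 0 = 0"
  "lin f (p + q) = lin f p + lin f q"
  "lin f (Poly_Mapping.single m a) = a * f m"
  "lin f (\<Sum>i\<in>A. g i) = (\<Sum>i\<in>A. lin f (g i))"
  by (simp_all add: lin_def extend_sum_add extend_sum_single extend_sum_sum ring_distribs)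

lemma lin_diff: "lin f (p - q) = lin f p - lin f q"
  using lin_simps(2)[of f "p - q" q] by simp

lemma lin_scale: "lin f (Poly_Mapping.single 0 c * p) = c * lin f p"
  for p :: "('m::monoid_add) \<Rightarrow>\<^sub>0 'k::field"
proof -
  have "lin f (Poly_Mapping.single 0 c * p) =
      lin f (\<Sum>m\<in>Poly_Mapping.keys p. Poly_Mapping.single m (c * Poly_Mapping.lookup p m))"
    by (subst poly_mapping_sum_single[of p]) (simp add: sum_distrib_left mult_single)
  also have "\<dots> = c * lin f p"
    by (subst (2) poly_mapping_sum_single[of p]) (simp add: lin_simps sum_distrib_left mult.assoc)
  finally show ?thesis .
qed

text \<open>A functional need not respect products, so its kernel need not be an ideal. The
  polynomials all of whose monomial multiples it kills do form one, by linearity, and this ideal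
  contains \<open>G\<close>.\<close>

lemma lin_eq_zero_on_genideal:
  fixes G :: "('v, 'k::field) mpoly set"
  assumes G: "G \<subseteq> carrier (mpoly_ring V)"
    and van: "\<And>g u. g \<in> G \<Longrightarrow> u \<in> monomials V \<Longrightarrow> lin f (monom_of u * g) = 0"
    and p: "p \<in> Idl\<^bsub>mpoly_ring V\<^esub> G"
  shows "lin f p = 0"
proof -
  define J :: "('v, 'k) mpoly set"
    where "J = {p \<in> carrier (mpoly_ring V). \<forall>u\<in>monomials V. lin f (monom_of u * p) = 0}"
  have "ideal J (mpoly_ring V)"
  proof (rule ideal_mpoly_ringI)
    fix p q :: "('v, 'k) mpoly" assume p: "p \<in> J" and q: "q \<in> carrier (mpoly_ring V)"
    have "lin f (monom_of u * (q * p)) = 0" if u: "u \<in> monomials V" for u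
    proof -
      have "monom_of u * (q * p) = (\<Sum>v\<in>Poly_Mapping.keys q.
          Poly_Mapping.single 0 (Poly_Mapping.lookup q v) * (monom_of (u + v) * p))"
        by (subst poly_mapping_sum_single[of q])
           (simp add: sum_distrib_left sum_distrib_right mult_single flip: mult.assoc)
      also have "lin f \<dots> = 0"
        using p q u by (auto simp: lin_simps lin_scale J_def carrier_mpoly_ring keys_plus_nat subset_iff intro!: sum.neutral)
      finally show ?thesis .
    qed
    then show "q * p \<in> J" using p q by (auto simp: J_def intro: carrier_closed)
  qed (auto simp: J_def lin_simps ring_distribs intro: carrier_closed)
  moreover have "G \<subseteq> J" using G van by (auto simp: J_def)
  ultimately have "Idl\<^bsub>mpoly_ring V\<^esub> G \<subseteq> J"
    by (rule ring.genideal_minimal[OF mpoly_ring_ring])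
  then have "lin f (monom_of 0 * p) = 0" using p by (auto simp: J_def simp del: single_one)
  then show ?thesis by simp
qed

lemma mpoly_consts_subfield:
  "subfield (range mpoly_const) (mpoly_ring V :: ('v, 'k::field) mpoly ring)"
proof (rule ring.subfield_iff(1)[OF mpoly_ring_ring])
  let ?K = "range mpoly_const :: ('v, 'k) mpoly set"
  let ?R = "mpoly_ring V :: ('v, 'k) mpoly ring"
  have hom: "mpoly_const a + mpoly_const b = (mpoly_const (a + b) :: ('v, 'k) mpoly)"
     "mpoly_const a * mpoly_const b = (mpoly_const (a * b) :: ('v, 'k) mpoly)"
     "mpoly_const 0 = (0 :: ('v, 'k) mpoly)" "mpoly_const 1 = (1 :: ('v, 'k) mpoly)" for a b :: 'k
    by (simp_all add: mpoly_const_def single_add mult_single)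
  have zero: "0 \<in> ?K" and one: "1 \<in> ?K" by (metis hom(3) rangeI, metis hom(4) rangeI)
  show sub: "?K \<subseteq> carrier ?R" by (auto simp: mpoly_const_def intro: carrier_closed)
  have "cring (?R \<lparr>carrier := ?K\<rparr>)"
  proof (rule cringI)
    show "abelian_group (?R \<lparr>carrier := ?K\<rparr>)"
    proof (rule abelian_groupI)
      fix x assume "x \<in> carrier (?R \<lparr>carrier := ?K\<rparr>)"
      then obtain a where "x = mpoly_const a" by auto
      then show "\<exists>y\<in>carrier (?R \<lparr>carrier := ?K\<rparr>). y \<oplus>\<^bsub>?R \<lparr>carrier := ?K\<rparr>\<^esub> x = \<zero>\<^bsub>?R \<lparr>carrier := ?K\<rparr>\<^esub>"
        by (intro bexI[of _ "mpoly_const (- a)"]) (simp_all add: hom)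
    qed (use zero in \<open>auto simp: hom add_ac\<close>)
    show "comm_monoid (?R \<lparr>carrier := ?K\<rparr>)"
      by (rule comm_monoidI) (use one in \<open>auto simp: hom mult_ac\<close>)
  qed (simp add: ring_distribs)
  then show "field (?R \<lparr>carrier := ?K\<rparr>)"
  proof (rule cring.cring_fieldI2)
    fix x assume "x \<in> carrier (?R \<lparr>carrier := ?K\<rparr>)" "x \<noteq> \<zero>\<^bsub>?R \<lparr>carrier := ?K\<rparr>\<^esub>"
    then obtain a where "x = mpoly_const a" "x \<noteq> 0" by auto
    moreover from this have "a \<noteq> 0" using hom(3) by auto
    ultimately show "\<exists>y\<in>carrier (?R \<lparr>carrier := ?K\<rparr>). x \<otimes>\<^bsub>?R \<lparr>carrier := ?K\<rparr>\<^esub> y = \<one>\<^bsub>?R \<lparr>carrier := ?K\<rparr>\<^esub>"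
      by (intro bexI[of _ "mpoly_const (inverse a)"]) (simp_all add: hom)
  qed simp
qed

text \<open>\<open>merge\<close> makes the classes span the quotient and \<open>vanish\<close> makes
  them independent, so they index a basis; \<open>degree\<close> makes this basis compatible with
  the grading.\<close>

locale monomial_classes =
  fixes V :: "'v set" and I :: "('v, 'k::field) mpoly set" and cls :: "('v \<Rightarrow>\<^sub>0 nat) \<Rightarrow> 'c"
  assumes ideal: "ideal I (mpoly_ring V)"
    and vanish: "\<And>p \<kappa>. p \<in> I \<Longrightarrow> lin (\<lambda>m. of_bool (cls m = \<kappa>)) p = 0"
    and merge: "\<And>m m'. m \<in> monomials V \<Longrightarrow> m' \<in> monomials V \<Longrightarrow> cls m = cls m' \<Longrightarrow>
                  monom_of m - monom_of m' \<in> I"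
    and degree: "\<And>m m'. m \<in> monomials V \<Longrightarrow> m' \<in> monomials V \<Longrightarrow> cls m = cls m' \<Longrightarrow>
                  mono_degree m = mono_degree m'"
begin

definition rep :: "'c \<Rightarrow> 'v \<Rightarrow>\<^sub>0 nat" where
  "rep \<kappa> = (SOME m. m \<in> monomials V \<and> cls m = \<kappa>)"

lemma rep: assumes "m \<in> monomials V" shows "rep (cls m) \<in> monomials V" "cls (rep (cls m)) = cls m"
proof -
  have "rep (cls m) \<in> monomials V \<and> cls (rep (cls m)) = cls m"
    unfolding rep_def by (rule someI[where x = m]) (use assms in auto)
  then show "rep (cls m) \<in> monomials V" "cls (rep (cls m)) = cls m" by auto
qed

text \<open>Each monomial is replaced by the representative of its class, which changes
  \<open>p\<close> only by an element of \<open>I\<close>.\<close>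

definition normal_form :: "('v, 'k) mpoly \<Rightarrow> ('v, 'k) mpoly" where
  "normal_form p = (\<Sum>m\<in>Poly_Mapping.keys p. Poly_Mapping.single (rep (cls m)) (Poly_Mapping.lookup p m))"

lemma diff_normal_form:
  assumes "p \<in> carrier (mpoly_ring V)"
  shows "p - normal_form p \<in> I"
proof -
  have "p - normal_form p = (\<Sum>m\<in>Poly_Mapping.keys p. Poly_Mapping.single 0 (Poly_Mapping.lookup p m) *
      (monom_of m - monom_of (rep (cls m))))"
    by (subst (1) poly_mapping_sum_single[of p])
       (simp add: normal_form_def right_diff_distrib mult_single sum_subtractf)
  also have "\<dots> \<in> I"
  proof (rule ideal_mpoly_ring_sum[OF ideal], rule ideal_mpoly_ringD(5)[OF ideal])
    fix m assume "m \<in> Poly_Mapping.keys p"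
    then have "m \<in> monomials V" using assms by (auto simp: carrier_mpoly_ring)
    then show "monom_of m - monom_of (rep (cls m)) \<in> I" by (intro merge) (simp_all only: rep)
  qed (simp add: carrier_closed)
  finally show ?thesis .
qed

lemma keys_normal_form:
  "Poly_Mapping.keys (normal_form p) \<subseteq> (\<lambda>m. rep (cls m)) ` Poly_Mapping.keys p"
  unfolding normal_form_def by (rule order.trans[OF keys_sum]) auto

lemma carrier_normal_form:
  "p \<in> carrier (mpoly_ring V) \<Longrightarrow> normal_form p \<in> carrier (mpoly_ring V)"
  using keys_normal_form[of p] rep(1) by (fastforce simp: carrier_mpoly_ring)

lemma lin_class_eq_lookup:
  assumes "inj_on cls (Poly_Mapping.keys p)" "m \<in> Poly_Mapping.keys p"
  shows "lin (\<lambda>m'. of_bool (cls m' = cls m)) p = Poly_Mapping.lookup p m"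
proof -
  have "lin (\<lambda>m'. of_bool (cls m' = cls m)) p =
      (\<Sum>m'\<in>Poly_Mapping.keys p. if m' = m then Poly_Mapping.lookup p m' else 0)"
    unfolding lin_def extend_sum_def using assms by (intro sum.cong) (auto simp: inj_on_def)
  then show ?thesis using assms(2) by simp
qed

text \<open>If the monomials of \<open>p\<close> lie in different classes, each class sum is a
  single coefficient, and all class sums vanish on \<open>I\<close>.\<close>

lemma eq_zero_if_mem_ideal:
  assumes "p \<in> I" "inj_on cls (Poly_Mapping.keys p)"
  shows "p = 0"
  using lin_class_eq_lookup[OF assms(2)] vanish[OF assms(1)]
  by (intro poly_mapping_eqI) (metis in_keys_iff lookup_zero)

lemma inj_on_cls_normal_form:
  assumes "p \<in> carrier (mpoly_ring V)"
  shows "inj_on cls (Poly_Mapping.keys (normal_form p))"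
proof (rule inj_on_subset[OF _ keys_normal_form])
  show "inj_on cls ((\<lambda>m. rep (cls m)) ` Poly_Mapping.keys p)"
    using assms rep(2) by (auto simp: inj_on_def carrier_mpoly_ring subset_iff)
qed

lemma one_notin: "1 \<notin> I"
proof
  assume "1 \<in> I"
  then have "(1 :: ('v, 'k) mpoly) = 0" by (rule eq_zero_if_mem_ideal) simp
  then show False by simp
qed

abbreviation Q where "Q \<equiv> mpoly_ring V Quot I"
abbreviation coset where "coset \<equiv> (+>\<^bsub>mpoly_ring V\<^esub>) I"

lemma coset_eq_iff:
  assumes "p \<in> carrier (mpoly_ring V)" "q \<in> carrier (mpoly_ring V)"
  shows "coset p = coset q \<longleftrightarrow> p - q \<in> I"
  using ring.quotient_eq_iff_same_a_r_cos[OF mpoly_ring_ring ideal assms]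
  by (simp add: mpoly_ring_a_minus assms)

lemma coset_hom: "ring_hom_ring (mpoly_ring V) Q coset"
  by (rule ideal.rcos_ring_hom_ring[OF ideal])

lemma quot_scalars_subfield: "subfield (quot_scalars V I) Q"
proof -
  interpret ring_hom_ring "mpoly_ring V" Q coset by (rule coset_hom)
  have "coset 1 \<noteq> coset 0"
    using one_notin by (subst coset_eq_iff) (auto intro: carrier_closed)
  then have "\<one>\<^bsub>Q\<^esub> \<noteq> \<zero>\<^bsub>Q\<^esub>"
    using hom_one hom_zero by simp
  from img_is_subfield(2)[OF mpoly_consts_subfield this]
  show ?thesis unfolding quot_scalars_def by (simp add: image_image)
qed

text \<open>Dimension is built up by line extensions, so monomials are added one at a time. A new
  monomial congruent to a combination \<open>p\<close> of the old ones would make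
  \<open>monom_of m - p\<close> a nonzero element of \<open>I\<close> with monomials in distinct
  classes.\<close>

lemma dimension_independent_monomials:
  assumes "finite M" "M \<subseteq> monomials V" "inj_on cls M"
  shows "ring.dimension Q (card M) (quot_scalars V I) (coset ` {p. Poly_Mapping.keys p \<subseteq> M})"
  using assms
proof (induction M)
  case empty
  interpret hom: ring_hom_ring "mpoly_ring V" Q coset by (rule coset_hom)
  have "{p :: ('v, 'k) mpoly. Poly_Mapping.keys p \<subseteq> {}} = {0}" by auto
  then have "coset ` {p. Poly_Mapping.keys p \<subseteq> {}} = {\<zero>\<^bsub>Q\<^esub>}"
    using hom.hom_zero by simp
  then show ?case using hom.S.dimension.zero_dim by simp
next
  case (insert m M)
  interpret hom: ring_hom_ring "mpoly_ring V" Q coset by (rule coset_hom)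
  let ?K = "quot_scalars V I"
  let ?E = "coset ` {p. Poly_Mapping.keys p \<subseteq> M}"
  let ?E' = "coset ` {p. Poly_Mapping.keys p \<subseteq> insert m M}"
  have carr: "p \<in> carrier (mpoly_ring V)" if "Poly_Mapping.keys p \<subseteq> insert m M" for p :: "('v, 'k) mpoly"
    using that insert.prems by (auto simp: carrier_mpoly_ring)
  have m: "(monom_of m :: ('v, 'k) mpoly) \<in> carrier (mpoly_ring V)" by (rule carr) simp
  have c: "mpoly_const c \<in> carrier (mpoly_ring V)" for c :: 'k by (simp add: mpoly_const_def carrier_closed)
  have lincomb: "coset (mpoly_const c * monom_of m + p) =
      coset (mpoly_const c) \<otimes>\<^bsub>Q\<^esub> coset (monom_of m) \<oplus>\<^bsub>Q\<^esub> coset p"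
    if "Poly_Mapping.keys p \<subseteq> insert m M" for c and p :: "('v, 'k) mpoly"
    using hom.hom_mult[OF c m, of c] hom.hom_add[OF hom.R.m_closed[OF c m, of c] carr[OF that]] by simp
  have "ring.dimension Q (Suc (card M)) ?K (ring.line_extension Q ?K (coset (monom_of m)) ?E)"
  proof (rule hom.S.dimension.Suc_dim)
    show "coset (monom_of m) \<in> carrier Q" using m by (rule hom.hom_closed)
    show "coset (monom_of m) \<notin> ?E"
    proof
      assume "coset (monom_of m) \<in> ?E"
      then obtain p where p: "Poly_Mapping.keys p \<subseteq> M" "coset (monom_of m) = coset p" by auto
      then have "monom_of m - p \<in> I" using coset_eq_iff[OF m, of p] carr by auto
      moreover have "Poly_Mapping.keys (monom_of m - p) \<subseteq> insert m M"
        using keys_diff[of "monom_of m" p] p(1) by auto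
      ultimately have "monom_of m - p = 0"
        using insert.prems by (intro eq_zero_if_mem_ideal) (auto intro: inj_on_subset)
      then have "m \<in> Poly_Mapping.keys p" by (metis eq_iff_diff_eq_0 keys_single insertI1 one_neq_zero)
      then show False using p(1) insert.hyps by auto
    qed
    show "ring.dimension Q (card M) ?K ?E" using insert by auto
  qed
  also have "ring.line_extension Q ?K (coset (monom_of m)) ?E = ?E'"
  proof (intro equalityI subsetI)
    fix x assume "x \<in> ring.line_extension Q ?K (coset (monom_of m)) ?E"
    then obtain k e where ke: "k \<in> ?K" "e \<in> ?E" "x = k \<otimes>\<^bsub>Q\<^esub> coset (monom_of m) \<oplus>\<^bsub>Q\<^esub> e"
      unfolding hom.S.line_extension_mem_iff by blast
    then obtain c p where p: "Poly_Mapping.keys p \<subseteq> M" "e = coset p" and c: "k = coset (mpoly_const c)"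
      by (auto simp: quot_scalars_def)
    have "x = coset (mpoly_const c * monom_of m + p)"
      using ke(3) p c lincomb[of p c] by auto
    moreover have "Poly_Mapping.keys (mpoly_const c * monom_of m + p) \<subseteq> insert m M"
      using p by (intro order.trans[OF keys_add]) (auto simp: mpoly_const_def mult_single)
    ultimately show "x \<in> ?E'" by blast
  next
    fix x assume "x \<in> ?E'"
    then obtain p where p: "Poly_Mapping.keys p \<subseteq> insert m M" "x = coset p" by auto
    let ?c = "Poly_Mapping.lookup p m"
    let ?q = "p - Poly_Mapping.single m ?c"
    have q: "Poly_Mapping.keys ?q \<subseteq> M" using p(1)
      by (auto simp: in_keys_iff lookup_minus lookup_single when_def subset_iff split: if_splits)
    have "p = mpoly_const ?c * monom_of m + ?q" by (simp add: mpoly_const_def mult_single)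
    then have "x = coset (mpoly_const ?c) \<otimes>\<^bsub>Q\<^esub> coset (monom_of m) \<oplus>\<^bsub>Q\<^esub> coset ?q"
      using p(2) lincomb[of ?q ?c] q by (metis subset_insertI2)
    moreover have "coset (mpoly_const ?c) \<in> ?K" by (simp add: quot_scalars_def)
    moreover have "coset ?q \<in> ?E" using q by blast
    ultimately show "x \<in> ring.line_extension Q ?K (coset (monom_of m)) ?E"
      unfolding hom.S.line_extension_mem_iff by blast
  qed
  finally show ?case using insert.hyps by simp
qed

text \<open>One representative per class is an independent set, and normal forms show that it spans.
  Since classes are homogeneous, representatives stay in degree \<open>d\<close>.\<close>

lemma hilbert_function_eq:
  assumes "finite (cls ` {m \<in> monomials V. mono_degree m = d})"
  shows "hilbert_function V I d = card (cls ` {m \<in> monomials V. mono_degree m = d})"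
proof -
  let ?D = "{m \<in> monomials V. mono_degree m = d}"
  let ?M = "rep ` cls ` ?D"
  interpret hom: ring_hom_ring "mpoly_ring V" Q coset by (rule coset_hom)
  have repD: "rep (cls m) \<in> ?D" if "m \<in> ?D" for m
    using rep[of m] degree[of "rep (cls m)" m] that by auto
  have M: "finite ?M" "?M \<subseteq> monomials V" "inj_on cls ?M"
    using assms rep by (auto simp: inj_on_def)
  have "quot_component V I d = coset ` {p. Poly_Mapping.keys p \<subseteq> ?M}"
  proof (intro equalityI subsetI)
    fix x assume "x \<in> quot_component V I d"
    then obtain p where p: "p \<in> mpoly_component V d" "x = coset p" by (auto simp: quot_component_def)
    then have pc: "p \<in> carrier (mpoly_ring V)" and pD: "Poly_Mapping.keys p \<subseteq> ?D"
      by (auto simp: mpoly_component_def carrier_mpoly_ring)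
    have "x = coset (normal_form p)"
      using p(2) coset_eq_iff[OF pc carrier_normal_form[OF pc]] diff_normal_form[OF pc] by simp
    moreover have "Poly_Mapping.keys (normal_form p) \<subseteq> ?M"
      using keys_normal_form[of p] pD by blast
    ultimately show "x \<in> coset ` {p. Poly_Mapping.keys p \<subseteq> ?M}" by auto
  next
    fix x assume "x \<in> coset ` {p. Poly_Mapping.keys p \<subseteq> ?M}"
    then obtain p where p: "Poly_Mapping.keys p \<subseteq> ?M" "x = coset p" by auto
    have "Poly_Mapping.keys p \<subseteq> ?D" using repD p(1) by blast
    then have "p \<in> mpoly_component V d"
      by (auto simp: mpoly_component_def carrier_mpoly_ring)
    then show "x \<in> quot_component V I d" using p(2) by (auto simp: quot_component_def)
  qed
  then have "hom.S.dimension (card ?M) (quot_scalars V I) (quot_component V I d)"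
    using dimension_independent_monomials[OF M] by simp
  from hom.S.dimI[OF quot_scalars_subfield this]
  have "hilbert_function V I d = card ?M" by (simp add: hilbert_function_def over_def)
  also have "card ?M = card (cls ` ?D)"
  proof (rule card_image, rule inj_onI)
    have inv: "cls (rep \<kappa>) = \<kappa>" if "\<kappa> \<in> cls ` ?D" for \<kappa>
    proof -
      from that obtain m where "m \<in> monomials V" "\<kappa> = cls m" by blast
      then show ?thesis by (simp only: rep)
    qed
    fix \<kappa> \<kappa>' assume "\<kappa> \<in> cls ` ?D" "\<kappa>' \<in> cls ` ?D" "rep \<kappa> = rep \<kappa>'"
    then show "\<kappa> = \<kappa>'" by (metis inv)
  qed
  finally show ?thesis .
qed

end

section \<open>Classes of monomials modulo the ideal of the cycle\<close>

text \<open>All four columns involved are nonzero, so the list is not cut between the two neighbours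
  and an exchange only moves x-degree within one piece.\<close>

lemma tail_sums_swap:
  "tail_sums r s (xs @ (Suc a, b) # (a', Suc b') # ys) = tail_sums r s (xs @ (a, Suc b) # (Suc a', b') # ys)"
  by (induction xs arbitrary: s) auto

lemma cyc_sums_swap:
  "cyc_sums s (xs @ (Suc a, b) # (a', Suc b') # ys) = cyc_sums s (xs @ (a, Suc b) # (Suc a', b') # ys)"
  by (induction xs arbitrary: s) (auto simp: tail_sums_swap)

text \<open>The last column is nonzero and hence belongs to the piece that is merged with the first
  one. This is the exchange along the edge from \<open>1\<close> to \<open>n\<close>.\<close>

lemma tail_sums_wrap: "tail_sums (Suc r) s (ys @ [(a, Suc b)]) = tail_sums r s (ys @ [(Suc a, b)])"
  by (induction ys arbitrary: s) auto

lemma cyc_sums_wrap: "cyc_sums (Suc s) (ys @ [(a, Suc b)]) = cyc_sums s (ys @ [(Suc a, b)])"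
  by (induction ys arbitrary: s) (auto simp: tail_sums_wrap)

section \<open>Columns and the class of a monomial\<close>

abbreviation xvar :: "nat \<Rightarrow> bvar \<Rightarrow>\<^sub>0 nat" where "xvar i \<equiv> Poly_Mapping.single (X i) (Suc 0)"
abbreviation yvar :: "nat \<Rightarrow> bvar \<Rightarrow>\<^sub>0 nat" where "yvar i \<equiv> Poly_Mapping.single (Y i) (Suc 0)"

definition col :: "(bvar \<Rightarrow>\<^sub>0 nat) \<Rightarrow> nat \<Rightarrow> nat \<times> nat" where
  "col m i = (Poly_Mapping.lookup m (X i), Poly_Mapping.lookup m (Y i))"

text \<open>The capacities determine the components, so a bare list of x-degrees suffices for the
  second entry. Adjacent zero columns produce empty pieces, recorded as \<open>0\<close>.\<close>

definition cyc_class :: "nat \<Rightarrow> (bvar \<Rightarrow>\<^sub>0 nat) \<Rightarrow> nat list \<times> nat list" where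
  "cyc_class n m =
     (map (\<lambda>i. col_size (col m i)) [1..<Suc n], cyc_sums 0 (map (col m) [1..<Suc n]))"

lemma col_add: "col (m + m') i = (fst (col m i) + fst (col m' i), snd (col m i) + snd (col m' i))"
  by (simp add: col_def lookup_add)

lemma col_size_add: "col_size (col (m + m') i) = col_size (col m i) + col_size (col m' i)"
  by (simp add: col_add col_size_def)

lemma col_xvar: "col (xvar i) k = (if k = i then (1, 0) else (0, 0))"
  and col_yvar: "col (yvar i) k = (if k = i then (0, 1) else (0, 0))"
  by (auto simp: col_def lookup_single when_def)

lemma mono_eqI:
  assumes "\<And>i. col m i = col m' i"
  shows "m = m'"
proof (rule poly_mapping_eqI)
  fix v show "Poly_Mapping.lookup m v = Poly_Mapping.lookup m' v"
    using assms by (cases v) (auto simp: col_def)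
qed

lemma finite_bvars: "finite (bvars n)"
  by (simp add: bvars_def)

lemma monomials_bvars_iff: "m \<in> monomials (bvars n) \<longleftrightarrow> (\<forall>i. i \<notin> {1..n} \<longrightarrow> col m i = (0, 0))"
proof
  assume "m \<in> monomials (bvars n)"
  then show "\<forall>i. i \<notin> {1..n} \<longrightarrow> col m i = (0, 0)"
    unfolding col_def bvars_def by (auto simp: in_keys_iff subset_iff)
next
  assume h: "\<forall>i. i \<notin> {1..n} \<longrightarrow> col m i = (0, 0)"
  have "v \<in> bvars n" if "v \<in> Poly_Mapping.keys m" for v
  proof (cases v)
    case (X i)
    then have "col m i \<noteq> (0, 0)" using that by (simp add: in_keys_iff col_def)
    then have "i \<in> {1..n}" using h by blast
    then show ?thesis using X by (simp add: bvars_def)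
  next
    case (Y i)
    then have "col m i \<noteq> (0, 0)" using that by (simp add: in_keys_iff col_def)
    then have "i \<in> {1..n}" using h by blast
    then show ?thesis using Y by (simp add: bvars_def)
  qed
  then show "m \<in> monomials (bvars n)" by blast
qed

lemma col_outside: "m \<in> monomials (bvars n) \<Longrightarrow> i \<notin> {1..n} \<Longrightarrow> col m i = (0, 0)"
  unfolding monomials_bvars_iff by blast

lemma ex_mono:
  assumes "\<And>i. i \<notin> {1..n} \<Longrightarrow> f i = (0, 0)"
  shows "\<exists>m\<in>monomials (bvars n). \<forall>i. col m i = f i"
proof -
  let ?g = "\<lambda>v. case v of X i \<Rightarrow> fst (f i) | Y i \<Rightarrow> snd (f i)"
  have "{v. ?g v \<noteq> 0} \<subseteq> bvars n"
  proof
    fix v assume v: "v \<in> {v. ?g v \<noteq> 0}"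
    show "v \<in> bvars n"
    proof (cases v)
      case (X i)
      then have "i \<in> {1..n}" using v assms[of i] by (cases "i \<in> {1..n}") auto
      then show ?thesis using X by (simp add: bvars_def)
    next
      case (Y i)
      then have "i \<in> {1..n}" using v assms[of i] by (cases "i \<in> {1..n}") auto
      then show ?thesis using Y by (simp add: bvars_def)
    qed
  qed
  then have "finite {v. ?g v \<noteq> 0}" using finite_bvars by (rule finite_subset)
  then have "col (Abs_poly_mapping ?g) i = f i" for i
    by (simp add: col_def)
  then show ?thesis using assms by (intro bexI[of _ "Abs_poly_mapping ?g"]) (simp_all only: monomials_bvars_iff, blast+)
qed

lemma mono_degree_eq_sum_list:
  assumes "m \<in> monomials (bvars n)"
  shows "mono_degree m = sum_list (fst (cyc_class n m))"
proof -
  have "mono_degree m = (\<Sum>v\<in>bvars n. Poly_Mapping.lookup m v)"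
    unfolding mono_degree_def using assms finite_bvars
    by (intro sum.mono_neutral_left) (auto simp: in_keys_iff)
  also have "\<dots> = (\<Sum>v\<in>X ` {1..n}. Poly_Mapping.lookup m v) + (\<Sum>v\<in>Y ` {1..n}. Poly_Mapping.lookup m v)"
    unfolding bvars_def by (rule sum.union_disjoint) auto
  also have "\<dots> = (\<Sum>i\<in>{1..n}. col_size (col m i))"
    by (simp add: sum.reindex inj_on_def col_def sum.distrib)
  also have "\<dots> = sum_list (fst (cyc_class n m))"
    unfolding cyc_class_def by (simp add: sum_list_distinct_conv_sum_set atLeastLessThanSuc_atLeastAtMost del: upt_Suc)
  finally show ?thesis .
qed

lemma cyc_class_edge:
  assumes ij: "i \<in> {1..n}" "j \<in> {1..n}" "i < j" and E: "{i, j} \<in> cycle_edges n"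
  shows "cyc_class n (u + (xvar i + yvar j)) = cyc_class n (u + (xvar j + yvar i))"
proof -
  let ?m = "u + (xvar i + yvar j)" and ?m' = "u + (xvar j + yvar i)"
  have other: "col ?m k = col ?m' k" if "k \<noteq> i" "k \<noteq> j" for k
    using that by (simp add: col_add col_xvar col_yvar)
  obtain a b a' b' where u: "col u i = (a, b)" "col u j = (a', b')" by fastforce
  have m: "col ?m i = (Suc a, b)" "col ?m j = (a', Suc b')"
      "col ?m' i = (a, Suc b)" "col ?m' j = (Suc a', b')"
    using \<open>i < j\<close> by (simp_all add: col_add col_xvar col_yvar u)
  have "col_size (col ?m k) = col_size (col ?m' k)" for k
    using m other by (cases "k = i"; cases "k = j") auto
  moreover have "cyc_sums 0 (map (col ?m) [1..<Suc n]) = cyc_sums 0 (map (col ?m') [1..<Suc n])"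
  proof -
    from E ij consider "j = Suc i" | "i = 1" "j = n"
      by (auto simp: cycle_edges_def doubleton_eq_iff)
    then show ?thesis
    proof cases
      case 1
      have "[1..<Suc n] = [1..<i] @ [i..<Suc n]"
        using ij upt_add_eq_append[of 1 i "Suc n - i"] by simp
      also have "[i..<Suc n] = i # j # [Suc j..<Suc n]"
        using ij 1 by (simp add: upt_conv_Cons del: upt_Suc)
      finally have split: "[1..<Suc n] = [1..<i] @ i # j # [Suc j..<Suc n]" .
      have "map (col ?m) [1..<i] = map (col ?m') [1..<i]" using ij other by auto
      moreover have "map (col ?m) [Suc j..<Suc n] = map (col ?m') [Suc j..<Suc n]"
        using ij other by (intro map_cong) auto
      ultimately show ?thesis
        unfolding split map_append list.map m cyc_sums_swap by (simp only:)
    next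
      case 2
      have split: "[1..<Suc n] = 1 # [Suc 1..<n] @ [n]"
        using ij 2 upt_Suc_append[of 1 n] upt_conv_Cons[of 1 n] by (simp del: upt_Suc)
      have ms: "map (col ?m) [Suc 1..<n] = map (col ?m') [Suc 1..<n]"
        using ij 2 other by (intro map_cong) auto
      have m1: "col ?m 1 = (Suc a, b)" "col ?m n = (a', Suc b')"
          "col ?m' 1 = (a, Suc b)" "col ?m' n = (Suc a', b')"
        using m 2 by simp_all
      show ?thesis
        unfolding split list.map map_append ms m1 by (simp add: cyc_sums_wrap)
    qed
  qed
  ultimately show ?thesis by (simp add: cyc_class_def)
qed

section \<open>Moving particles through the support\<close>

definition reach :: "nat \<Rightarrow> nat set set \<Rightarrow> (nat \<Rightarrow> nat) \<Rightarrow> (nat \<times> nat) set" where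
  "reach n E c = {(i, j). i \<in> {1..n} \<and> j \<in> {1..n} \<and> i \<noteq> j \<and> {i, j} \<in> E \<and> c i > 0 \<and> c j > 0}\<^sup>*"

lemma sym_reach: "sym (reach n E c)"
  unfolding reach_def by (rule sym_rtrancl) (auto simp: sym_def insert_commute)

lemma trans_reach: "trans (reach n E c)"
  unfolding reach_def by (rule trans_rtrancl)

text \<open>The argument \<open>K\<close> fixes the coefficient field, which the exponent vectors do
  not mention.\<close>

definition edge_equiv ::
    "'k::field itself \<Rightarrow> nat \<Rightarrow> nat set set \<Rightarrow> (bvar \<Rightarrow>\<^sub>0 nat) \<Rightarrow> (bvar \<Rightarrow>\<^sub>0 nat) \<Rightarrow> bool" where
  "edge_equiv K n E m m' \<longleftrightarrow> (monom_of m - monom_of m' :: (bvar, 'k) mpoly) \<in> binomial_edge_ideal n E"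

lemma edge_gens_carrier:
  "{mpoly_var (X i) * mpoly_var (Y j) - mpoly_var (X j) * mpoly_var (Y i) | i j.
      i \<in> {1..n} \<and> j \<in> {1..n} \<and> i < j \<and> {i, j} \<in> E}
    \<subseteq> carrier (mpoly_ring (bvars n) :: (bvar, 'k::field) mpoly ring)"
  by (auto simp: mpoly_var_def bvars_def intro!: carrier_closed)

lemma ideal_binomial_edge_ideal:
  "ideal (binomial_edge_ideal n E) (mpoly_ring (bvars n) :: (bvar, 'k::field) mpoly ring)"
  unfolding binomial_edge_ideal_def by (rule ring.genideal_ideal[OF mpoly_ring_ring edge_gens_carrier])

lemma edge_equiv_refl: "edge_equiv K n E m m"
  using ideal_mpoly_ringD(2)[OF ideal_binomial_edge_ideal] by (simp add: edge_equiv_def)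

lemma edge_equiv_trans:
  assumes "edge_equiv (K :: 'k::field itself) n E m m'" "edge_equiv K n E m' m''"
  shows "edge_equiv K n E m m''"
  using ideal_mpoly_ringD(3)[OF ideal_binomial_edge_ideal assms[unfolded edge_equiv_def]]
  by (simp add: edge_equiv_def)

lemma edge_equiv_sym:
  assumes "edge_equiv (K :: 'k::field itself) n E m m'"
  shows "edge_equiv K n E m' m"
  using ideal_mpoly_ringD(4)[OF ideal_binomial_edge_ideal
      edge_equiv_refl[unfolded edge_equiv_def] assms[unfolded edge_equiv_def]]
  by (simp add: edge_equiv_def)

lemma edge_equiv_edge:
  assumes "i \<in> {1..n}" "j \<in> {1..n}" "i \<noteq> j" "{i, j} \<in> E" "u \<in> monomials (bvars n)"
  shows "edge_equiv (K :: 'k::field itself) n E (u + (xvar i + yvar j)) (u + (xvar j + yvar i))"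
proof -
  have *: "edge_equiv K n E (u + (xvar i + yvar j)) (u + (xvar j + yvar i))"
    if ij: "i \<in> {1..n}" "j \<in> {1..n}" "i < j" "{i, j} \<in> E" for i j
  proof -
    have "(mpoly_var (X i) * mpoly_var (Y j) - mpoly_var (X j) * mpoly_var (Y i) :: (bvar, 'k) mpoly)
        \<in> binomial_edge_ideal n E"
      unfolding binomial_edge_ideal_def
      by (rule subsetD[OF ring.genideal_self[OF mpoly_ring_ring edge_gens_carrier]]) (use ij in blast)
    from ideal_mpoly_ringD(5)[OF ideal_binomial_edge_ideal this carrier_closed(7)[OF assms(5), of 1]]
    show ?thesis by (simp add: edge_equiv_def mpoly_var_def mult_single right_diff_distrib)
  qed
  show ?thesis
  proof (cases "i < j")
    case False
    then have "j < i" using assms(3) by simp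
    from *[of j i, OF assms(2,1) this] edge_equiv_sym show ?thesis
      using assms(4) by (metis insert_commute)
  qed (use * assms in blast)
qed

lemma split_off_var:
  assumes "Poly_Mapping.lookup u v > (0::nat)" "u \<in> monomials V"
  obtains u' where "u = u' + Poly_Mapping.single v (Suc 0)" "u' \<in> monomials V"
proof
  show *: "u = (u - Poly_Mapping.single v (Suc 0)) + Poly_Mapping.single v (Suc 0)"
    using assms(1) by (intro poly_mapping_eqI) (auto simp: lookup_add lookup_minus lookup_single when_def)
  show "u - Poly_Mapping.single v (Suc 0) \<in> monomials V"
    using assms(2) by (subst (asm) *) (simp add: keys_plus_nat)
qed

text \<open>To move an \<open>x\<close> from \<open>i\<close> to \<open>j\<close> through the neighbour \<open>k\<close> of \<open>i\<close>, the order of the two steps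
  depends on whether column \<open>k\<close> offers a \<open>y\<close> (first \<open>i\<close> to \<open>k\<close>) or an \<open>x\<close> (first \<open>k\<close> to \<open>j\<close>).\<close>

lemma edge_equiv_swap:
  assumes "(i, j) \<in> reach n E c" "j \<in> {1..n}" "u \<in> monomials (bvars n)"
    and "\<And>k. col_size (col (u + (xvar i + yvar j)) k) = c k"
  shows "edge_equiv (K :: 'k::field itself) n E (u + (xvar i + yvar j)) (u + (xvar j + yvar i))"
  using assms(1,3,4) unfolding reach_def
proof (induction arbitrary: u rule: converse_rtrancl_induct)
  case base
  then show ?case by (simp add: edge_equiv_refl)
next
  case (step i k)
  note edge = step.hyps(1)
  let ?V = "monomials (bvars n)"
  have V: "xvar l \<in> ?V" "yvar l \<in> ?V" if "l \<in> {1..n}" for l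
    using that by (auto simp: bvars_def)
  have add: "m + m' \<in> ?V" if "m \<in> ?V" "m' \<in> ?V" for m m' :: "bvar \<Rightarrow>\<^sub>0 nat"
    using that by (simp add: keys_plus_nat)
  have i: "i \<in> {1..n}" and k: "k \<in> {1..n}" and ik: "i \<noteq> k" "{i, k} \<in> E" and ck: "c k > 0"
    using edge by auto
  consider "i = j" | "k = j" | "i \<noteq> j" "k \<noteq> j" by blast
  then show ?case
  proof cases
    case 1
    then show ?thesis by (simp add: edge_equiv_refl)
  next
    case 2
    then show ?thesis using edge_equiv_edge[OF i k ik step.prems(1)] by simp
  next
    case 3
    have "col_size (col u k) = c k"
      using step.prems(2)[of k] 3 ik by (simp add: col_size_add col_xvar col_yvar)
    then consider "Poly_Mapping.lookup u (Y k) > 0" | "Poly_Mapping.lookup u (X k) > 0"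
      using ck unfolding col_def col_size_Pair by linarith
    then show ?thesis
    proof cases
      case 1
      from split_off_var[OF this step.prems(1)]
      obtain u' where u': "u = u' + yvar k" "u' \<in> ?V" .
      have 1: "edge_equiv K n E ((u' + yvar j) + (xvar i + yvar k)) ((u' + yvar j) + (xvar k + yvar i))"
        using u'(2) assms(2) V by (intro edge_equiv_edge i k ik add) auto
      have 2: "edge_equiv K n E ((u' + yvar i) + (xvar k + yvar j)) ((u' + yvar i) + (xvar j + yvar k))"
      proof (rule step.IH)
        show "u' + yvar i \<in> ?V" using u'(2) V(2)[OF i] by (rule add)
        show "col_size (col (u' + yvar i + (xvar k + yvar j)) l) = c l" for l
          using step.prems(2)[of l] unfolding u'(1)
          by (auto simp: col_size_add col_xvar col_yvar split: if_splits)
      qed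
      have "(u' + yvar j) + (xvar k + yvar i) = (u' + yvar i) + (xvar k + yvar j)" by (simp add: add_ac)
      from edge_equiv_trans[OF 1[unfolded this] 2] show ?thesis unfolding u'(1) by (simp add: add_ac)
    next
      case 2
      from split_off_var[OF this step.prems(1)]
      obtain u' where u': "u = u' + xvar k" "u' \<in> ?V" .
      have 1: "edge_equiv K n E ((u' + xvar i) + (xvar k + yvar j)) ((u' + xvar i) + (xvar j + yvar k))"
      proof (rule step.IH)
        show "u' + xvar i \<in> ?V" using u'(2) V(1)[OF i] by (rule add)
        show "col_size (col (u' + xvar i + (xvar k + yvar j)) l) = c l" for l
          using step.prems(2)[of l] unfolding u'(1)
          by (auto simp: col_size_add col_xvar col_yvar split: if_splits)
      qed
      have 2: "edge_equiv K n E ((u' + xvar j) + (xvar i + yvar k)) ((u' + xvar j) + (xvar k + yvar i))"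
        using u'(2) assms(2) V by (intro edge_equiv_edge i k ik add) auto
      have "(u' + xvar i) + (xvar j + yvar k) = (u' + xvar j) + (xvar i + yvar k)" by (simp add: add_ac)
      from edge_equiv_trans[OF 1[unfolded this] 2] show ?thesis unfolding u'(1) by (simp add: add_ac)
    qed
  qed
qed

text \<open>Induction on the total surplus of \<open>m\<close> over \<open>m'\<close> on
  \<open>W\<close>; truncated subtraction counts only columns with too many particles. As the totals
  on \<open>W\<close> agree, a surplus at some \<open>i\<close> comes with a deficit at some
  \<open>j\<close>, and moving one particle from \<open>i\<close> to \<open>j\<close> lowers the
  measure.\<close>

lemma edge_equiv_rearrange:
  assumes "m \<in> monomials (bvars n)" "m' \<in> monomials (bvars n)"
    and "\<And>k. col_size (col m k) = c k" "\<And>k. col_size (col m' k) = c k"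
    and "W \<subseteq> {1..n}" "\<And>i j. i \<in> W \<Longrightarrow> j \<in> W \<Longrightarrow> (i, j) \<in> reach n E c"
    and "\<And>k. k \<notin> W \<Longrightarrow> fst (col m k) = fst (col m' k)"
    and "(\<Sum>k\<in>W. fst (col m k)) = (\<Sum>k\<in>W. fst (col m' k))"
  shows "edge_equiv (K :: 'k::field itself) n E m m'"
  using assms(1,3,7,8)
proof (induction "\<Sum>k\<in>W. fst (col m k) - fst (col m' k)" arbitrary: m rule: less_induct)
  case less
  have W: "finite W" using assms(5) finite_subset by blast
  have snd: "fst (col m k) + snd (col m k) = fst (col m' k) + snd (col m' k)" for k
    using less.prems(2)[of k] assms(4)[of k] by (simp add: col_size_def)
  show ?case
  proof (cases "\<forall>i\<in>W. fst (col m i) \<le> fst (col m' i)")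
    case True
    then have "fst (col m k) = fst (col m' k)" for k
      using less.prems(3,4) W sum_mono_inv[of "\<lambda>k. fst (col m k)" W "\<lambda>k. fst (col m' k)" k]
      by (cases "k \<in> W") auto
    then have "m = m'" using snd by (intro mono_eqI prod_eqI) (metis, metis add_left_cancel)
    then show ?thesis by (simp add: edge_equiv_refl)
  next
    case False
    then obtain i where i: "i \<in> W" "fst (col m i) > fst (col m' i)" by force
    have "\<exists>j\<in>W. fst (col m j) < fst (col m' j)"
    proof (rule ccontr)
      assume "\<not> ?thesis"
      then have "(\<Sum>k\<in>W. fst (col m' k)) < (\<Sum>k\<in>W. fst (col m k))"
        using i W by (intro sum_strict_mono_ex1) (auto simp: not_less)
      then show False using less.prems(4) by simp
    qed
    then obtain j where j: "j \<in> W" "fst (col m j) < fst (col m' j)" by blast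
    have ij: "i \<noteq> j" using i j by auto
    have "Poly_Mapping.lookup m (X i) > 0" using i by (simp add: col_def)
    from split_off_var[OF this less.prems(1)]
    obtain u1 where u1: "m = u1 + xvar i" "u1 \<in> monomials (bvars n)" .
    \<comment> \<open>The capacities agree, so a deficit of x at \<open>j\<close> means a hole
      there.\<close>
    have "snd (col m j) > 0" using snd[of j] j by simp
    then have "Poly_Mapping.lookup u1 (Y j) > 0" by (simp add: u1 col_def lookup_add lookup_single)
    from split_off_var[OF this u1(2)]
    obtain u where u: "u1 = u + yvar j" "u \<in> monomials (bvars n)" .
    have m: "m = u + (xvar i + yvar j)" by (simp add: u1 u add_ac)
    let ?m = "u + (xvar j + yvar i)"
    have in_n: "i \<in> {1..n}" "j \<in> {1..n}" using i j assms(5) by auto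
    have "edge_equiv K n E m ?m"
      unfolding m by (rule edge_equiv_swap[OF assms(6)[OF i(1) j(1)] in_n(2) u(2)]) (use less.prems(2) m in simp)
    moreover have "edge_equiv K n E ?m m'"
    proof (rule less.hyps)
      have fst_m: "fst (col m k) = (if k = i then Suc (fst (col ?m k)) else if k = j then fst (col ?m k) - 1 else fst (col ?m k))"
        "k = j \<Longrightarrow> fst (col ?m k) = Suc (fst (col m k))" for k
        using ij by (simp_all add: m col_add col_xvar col_yvar)
      show "(\<Sum>k\<in>W. fst (col ?m k) - fst (col m' k)) < (\<Sum>k\<in>W. fst (col m k) - fst (col m' k))"
      proof (rule sum_strict_mono_ex1[OF W])
        show "\<forall>k\<in>W. fst (col ?m k) - fst (col m' k) \<le> fst (col m k) - fst (col m' k)"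
          using fst_m j ij by (auto split: if_splits)
        show "\<exists>k\<in>W. fst (col ?m k) - fst (col m' k) < fst (col m k) - fst (col m' k)"
          using fst_m(1)[of i] i by (intro bexI[of _ i]) auto
      qed
      show "?m \<in> monomials (bvars n)"
        using u(2) in_n by (auto simp: keys_plus_nat bvars_def)
      show "col_size (col ?m k) = c k" for k
        using less.prems(2)[of k] ij unfolding m by (auto simp: col_size_add col_xvar col_yvar split: if_splits)
      show "fst (col ?m k) = fst (col m' k)" if "k \<notin> W" for k
      proof -
        have "k \<noteq> i" "k \<noteq> j" using that i j by auto
        then show ?thesis using less.prems(3)[OF that] fst_m(1)[of k] by simp
      qed
      have "(\<Sum>k\<in>W. fst (col m k)) = (\<Sum>k\<in>W. fst (col u k)) + 1"
      proof -
        have "fst (col m k) = fst (col u k) + (if k = i then 1 else 0)" for k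
          by (simp add: m col_add col_xvar col_yvar)
        then show ?thesis using i W by (simp only: sum.distrib sum.delta if_True)
      qed
      moreover have "(\<Sum>k\<in>W. fst (col ?m k)) = (\<Sum>k\<in>W. fst (col u k)) + 1"
      proof -
        have "fst (col ?m k) = fst (col u k) + (if k = j then 1 else 0)" for k
          by (simp add: col_add col_xvar col_yvar)
        then show ?thesis using j W by (simp only: sum.distrib sum.delta if_True)
      qed
      ultimately show "(\<Sum>k\<in>W. fst (col ?m k)) = (\<Sum>k\<in>W. fst (col m' k))"
        using less.prems(4) by simp
    qed
    ultimately show ?thesis by (rule edge_equiv_trans)
  qed
qed


section \<open>Completeness of the class invariant\<close>

lemma reach_interval:
  assumes "\<And>i. i \<in> {l..h} \<Longrightarrow> c i > 0" "{l..h} \<subseteq> {1..n}" "i \<in> {l..h}"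
  shows "(l, i) \<in> reach n (cycle_edges n) c"
  using assms(3)
proof (induction i)
  case 0
  then show ?case by (simp add: reach_def)
next
  case (Suc i)
  show ?case
  proof (cases "Suc i = l")
    case False
    then have i: "i \<in> {l..h}" using Suc.prems by auto
    have "{i, Suc i} \<in> cycle_edges n"
      using subsetD[OF assms(2) i] subsetD[OF assms(2) Suc.prems] by (auto simp: cycle_edges_def)
    moreover have "i \<in> {1..n}" "Suc i \<in> {1..n}" using i Suc.prems assms(2) by auto
    ultimately show ?thesis
      using Suc.IH[OF i] assms(1)[OF i] assms(1)[OF Suc.prems] unfolding reach_def
      by (elim rtrancl_into_rtrancl) auto
  qed (simp add: reach_def)
qed

lemma reach_if_common:
  assumes "\<And>i. i \<in> W \<Longrightarrow> (l, i) \<in> reach n E c" "i \<in> W" "j \<in> W"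
  shows "(i, j) \<in> reach n E c"
  using assms sym_reach trans_reach by (metis symE transE)

text \<open>Each interval is connected by itself, and the edge from \<open>1\<close> to
  \<open>n\<close> joins them when both are nonempty. This is the shape of the merged first and last
  piece.\<close>

lemma reach_wrapped_interval:
  assumes "n \<ge> 3" "p \<le> q" "q \<le> n" "\<And>i. i \<in> {1..p} \<union> {Suc q..n} \<Longrightarrow> c i > 0"
    and "i \<in> {1..p} \<union> {Suc q..n}" "j \<in> {1..p} \<union> {Suc q..n}"
  shows "(i, j) \<in> reach n (cycle_edges n) c"
proof -
  let ?R = "reach n (cycle_edges n) c"
  have right: "(Suc q, i) \<in> ?R" if "i \<in> {Suc q..n}" for i
    by (rule reach_interval[OF _ _ that]) (use assms in auto)
  have left: "(1, i) \<in> ?R" if "i \<in> {1..p}" for i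
    by (rule reach_interval[OF _ _ that]) (use assms in auto)
  show ?thesis
  proof (cases "p = 0")
    case True
    show ?thesis
      by (rule reach_if_common[where l = "Suc q" and W = "{Suc q..n}"]) (use assms(5,6) right True in auto)
  next
    case p: False
    have "(1, i) \<in> ?R" if i: "i \<in> {1..p} \<union> {Suc q..n}" for i
    proof (cases "i \<in> {1..p}")
      case False
      then have i': "i \<in> {Suc q..n}" using i by blast
      then have n: "n \<in> {Suc q..n}" by auto
      have "{1, n} \<in> cycle_edges n" by (simp add: cycle_edges_def)
      moreover have "c 1 > 0" "c n > 0" using assms(4) p n by auto
      ultimately have "(1, n) \<in> ?R"
        unfolding reach_def using assms(1) by (intro r_into_rtrancl) auto
      also have "(n, i) \<in> ?R" by (rule reach_if_common[OF right n i'])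
      finally (transD[OF trans_reach]) show ?thesis .
    qed (rule left)
    then show ?thesis using assms(5,6) by (rule reach_if_common)
  qed
qed

text \<open>The state of the scan after \<open>k\<close> columns: \<open>{1..p}\<close> is the first
  piece, still open because it may continue at the far end; on \<open>{Suc p..q}\<close> the two
  monomials already agree; \<open>{Suc q..k}\<close> is the piece being read. A zero column settles
  the current piece by a rearrangement inside it, and the end of the list settles the first and last
  piece together.\<close>

lemma edge_equiv_if_tail_sums:
  assumes "n \<ge> 3" "k \<le> n" "p \<le> q" "q \<le> k"
    and "m \<in> monomials (bvars n)" "m' \<in> monomials (bvars n)"
    and "\<And>i. col_size (col m i) = c i" "\<And>i. col_size (col m' i) = c i"
    and "\<And>i. i \<in> {1..p} \<union> {Suc q..k} \<Longrightarrow> c i > 0"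
    and "\<And>i. i \<in> {Suc p..q} \<Longrightarrow> fst (col m i) = fst (col m' i)"
    and "tail_sums (\<Sum>i\<in>{1..p}. fst (col m i)) (\<Sum>i\<in>{Suc q..k}. fst (col m i)) (map (col m) [Suc k..<Suc n]) =
         tail_sums (\<Sum>i\<in>{1..p}. fst (col m' i)) (\<Sum>i\<in>{Suc q..k}. fst (col m' i)) (map (col m') [Suc k..<Suc n])"
  shows "edge_equiv (K :: 'k::field itself) n (cycle_edges n) m m'"
  using assms(2-)
proof (induction "n - k" arbitrary: k q m)
  case 0
  then have k: "k = n" by simp
  let ?W = "{1..p} \<union> {Suc q..n}"
  show ?case
  proof (rule edge_equiv_rearrange[OF "0.prems"(4-7), where W = ?W])
    show "?W \<subseteq> {1..n}" using 0 by auto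
    show "(i, j) \<in> reach n (cycle_edges n) c" if "i \<in> ?W" "j \<in> ?W" for i j
      using reach_wrapped_interval[OF assms(1) _ _ _ that] "0.prems" k by auto
    show "fst (col m i) = fst (col m' i)" if "i \<notin> ?W" for i
    proof (cases "i \<in> {Suc p..q}")
      case False
      then have "i \<notin> {1..n}" using that by auto
      then show ?thesis using "0.prems"(4,5)[THEN col_outside] by simp
    qed (rule "0.prems"(9))
    have "{1..p} \<inter> {Suc q..n} = {}" using "0.prems" by auto
    then have "(\<Sum>i\<in>?W. fst (col m i)) = (\<Sum>i\<in>{1..p}. fst (col m i)) + (\<Sum>i\<in>{Suc q..n}. fst (col m i))" for m
      by (intro sum.union_disjoint) auto
    then show "(\<Sum>i\<in>?W. fst (col m i)) = (\<Sum>i\<in>?W. fst (col m' i))"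
      using "0.prems"(10) k by simp
  qed
next
  case (Suc d)
  note prems = Suc.prems
  have kn: "k < n" using Suc.hyps(2) by simp
  have d: "d = n - Suc k" using Suc.hyps(2) by simp
  have cons: "map (col m) [Suc k..<Suc n] = col m (Suc k) # map (col m) [Suc (Suc k)..<Suc n]" for m
    using kn by (simp add: upt_conv_Cons del: upt_Suc)
  show ?case
  proof (cases "c (Suc k) = 0")
    case False
    have step: "(\<Sum>i\<in>{Suc q..Suc k}. fst (col m i)) = (\<Sum>i\<in>{Suc q..k}. fst (col m i)) + fst (col m (Suc k))" for m
      using prems(3) by simp
    show ?thesis
    proof (rule Suc.hyps(1)[OF d _ prems(2) _ prems(4-7) _ prems(9)])
      show "c i > 0" if "i \<in> {1..p} \<union> {Suc q..Suc k}" for i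
        using that prems(8)[of i] False by (cases "i = Suc k") auto
      show "tail_sums (\<Sum>i\<in>{1..p}. fst (col m i)) (\<Sum>i\<in>{Suc q..Suc k}. fst (col m i)) (map (col m) [Suc (Suc k)..<Suc n]) =
         tail_sums (\<Sum>i\<in>{1..p}. fst (col m' i)) (\<Sum>i\<in>{Suc q..Suc k}. fst (col m' i)) (map (col m') [Suc (Suc k)..<Suc n])"
        using prems(10) False unfolding cons step by (simp add: prems(6,7) del: upt_Suc)
    qed (use kn prems(3) in auto)
  next
    case True
    then have sums: "(\<Sum>i\<in>{Suc q..k}. fst (col m i)) = (\<Sum>i\<in>{Suc q..k}. fst (col m' i))"
      and tails: "tail_sums (\<Sum>i\<in>{1..p}. fst (col m i)) 0 (map (col m) [Suc (Suc k)..<Suc n]) =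
         tail_sums (\<Sum>i\<in>{1..p}. fst (col m' i)) 0 (map (col m') [Suc (Suc k)..<Suc n])"
      using prems(10) unfolding cons by (simp_all add: prems(6,7) del: upt_Suc)
    \<comment> \<open>\<open>w\<close> is \<open>m\<close> with the closed piece replaced by that of
      \<open>m'\<close>; equal x-degrees on the piece make this a rearrangement.\<close>
    obtain w where w: "w \<in> monomials (bvars n)"
      "\<And>i. col w i = (if i \<in> {Suc q..k} then col m' i else col m i)"
      using ex_mono[of n "\<lambda>i. if i \<in> {Suc q..k} then col m' i else col m i"] prems(4,5)
      unfolding monomials_bvars_iff by (metis (no_types, lifting))
    have wc: "col_size (col w i) = c i" for i
      using prems(6,7) by (simp add: w(2))
    have "edge_equiv K n (cycle_edges n) m w"
    proof (rule edge_equiv_rearrange[OF prems(4) w(1) prems(6) wc, where W = "{Suc q..k}"])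
      show "{Suc q..k} \<subseteq> {1..n}" using kn by auto
      show "(i, j) \<in> reach n (cycle_edges n) c" if "i \<in> {Suc q..k}" "j \<in> {Suc q..k}" for i j
        using reach_interval[of "Suc q" k c n] prems(8) kn
        by (intro reach_if_common[OF _ that, where l = "Suc q"]) auto
    qed (use sums in \<open>auto simp: w(2)\<close>)
    moreover have "edge_equiv K n (cycle_edges n) w m'"
    \<comment> \<open>The settled region now extends through the zero column, that is
      \<open>q\<close> becomes \<open>Suc k\<close>, and the new current piece is the empty interval
      \<open>{Suc (Suc k)..Suc k}\<close>.\<close>
    proof (rule Suc.hyps(1)[OF d _ _ order_refl w(1) prems(5) wc prems(7)])
      show "Suc k \<le> n" "p \<le> Suc k" using kn prems by auto
      show "c i > 0" if "i \<in> {1..p} \<union> {Suc (Suc k)..Suc k}" for i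
        using that prems(8)[of i] by auto
      show "fst (col w i) = fst (col m' i)" if "i \<in> {Suc p..Suc k}" for i
      proof -
        consider "i \<in> {Suc p..q}" | "i \<in> {Suc q..k}" | "i = Suc k" using \<open>i \<in> {Suc p..Suc k}\<close> by force
        then show ?thesis
        proof cases
          case 3
          then show ?thesis using wc[of i] prems(7)[of i] True by (simp add: col_size_def)
        qed (use prems(9) in \<open>auto simp: w(2)\<close>)
      qed
      have "(\<Sum>i\<in>{1..p}. fst (col w i)) = (\<Sum>i\<in>{1..p}. fst (col m i))"
        using prems(2) by (intro sum.cong) (auto simp: w(2))
      moreover have "map (col w) [Suc (Suc k)..<Suc n] = map (col m) [Suc (Suc k)..<Suc n]"
        by (intro map_cong refl) (auto simp: w(2))
      ultimately show "tail_sums (\<Sum>i\<in>{1..p}. fst (col w i)) (\<Sum>i\<in>{Suc (Suc k)..Suc k}. fst (col w i)) (map (col w) [Suc (Suc k)..<Suc n]) =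
         tail_sums (\<Sum>i\<in>{1..p}. fst (col m' i)) (\<Sum>i\<in>{Suc (Suc k)..Suc k}. fst (col m' i)) (map (col m') [Suc (Suc k)..<Suc n])"
        using tails by (simp only:) simp
    qed
    ultimately show ?thesis by (rule edge_equiv_trans)
  qed
qed

text \<open>The scan up to the first zero column. That column fixes the first piece as
  \<open>{1..k}\<close> and passes to the previous lemma with only column \<open>Suc k\<close>
  settled; if no zero column occurs, all of \<open>{1..n}\<close> is connected.\<close>

lemma edge_equiv_if_cyc_sums:
  assumes "n \<ge> 3" "k \<le> n"
    and "m \<in> monomials (bvars n)" "m' \<in> monomials (bvars n)"
    and "\<And>i. col_size (col m i) = c i" "\<And>i. col_size (col m' i) = c i"
    and "\<And>i. i \<in> {1..k} \<Longrightarrow> c i > 0"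
    and "cyc_sums (\<Sum>i\<in>{1..k}. fst (col m i)) (map (col m) [Suc k..<Suc n]) =
         cyc_sums (\<Sum>i\<in>{1..k}. fst (col m' i)) (map (col m') [Suc k..<Suc n])"
  shows "edge_equiv (K :: 'k::field itself) n (cycle_edges n) m m'"
  using assms(2-)
proof (induction "n - k" arbitrary: k)
  case 0
  then have k: "k = n" by simp
  show ?case
  proof (rule edge_equiv_rearrange[OF "0.prems"(2-5), where W = "{1..n}"])
    show "(i, j) \<in> reach n (cycle_edges n) c" if "i \<in> {1..n}" "j \<in> {1..n}" for i j
      using reach_interval[of 1 n c n] "0.prems"(6) k
      by (intro reach_if_common[OF _ that, where l = 1]) auto
    show "fst (col m i) = fst (col m' i)" if "i \<notin> {1..n}" for i
      using "0.prems"(2,3)[THEN col_outside, OF that] by simp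
  qed (use "0.prems"(7) k in auto)
next
  case (Suc d)
  note prems = Suc.prems
  have kn: "k < n" using Suc.hyps(2) by simp
  have d: "d = n - Suc k" using Suc.hyps(2) by simp
  have cons: "map (col m) [Suc k..<Suc n] = col m (Suc k) # map (col m) [Suc (Suc k)..<Suc n]" for m
    using kn by (simp add: upt_conv_Cons del: upt_Suc)
  show ?case
  proof (cases "c (Suc k) = 0")
    case False
    have step: "(\<Sum>i\<in>{1..Suc k}. fst (col m i)) = (\<Sum>i\<in>{1..k}. fst (col m i)) + fst (col m (Suc k))" for m
      by simp
    show ?thesis
    proof (rule Suc.hyps(1)[OF d _ prems(2-5)])
      show "c i > 0" if "i \<in> {1..Suc k}" for i
        using that prems(6)[of i] False by (cases "i = Suc k") auto
      show "cyc_sums (\<Sum>i\<in>{1..Suc k}. fst (col m i)) (map (col m) [Suc (Suc k)..<Suc n]) =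
         cyc_sums (\<Sum>i\<in>{1..Suc k}. fst (col m' i)) (map (col m') [Suc (Suc k)..<Suc n])"
        using prems(7) False unfolding cons step by (simp add: prems(4,5) del: upt_Suc)
    qed (use kn in auto)
  next
    case True
    have tails: "tail_sums (\<Sum>i\<in>{1..k}. fst (col m i)) 0 (map (col m) [Suc (Suc k)..<Suc n]) =
         tail_sums (\<Sum>i\<in>{1..k}. fst (col m' i)) 0 (map (col m') [Suc (Suc k)..<Suc n])"
      using prems(7) True unfolding cons by (simp add: prems(4,5) del: upt_Suc)
    show ?thesis
    proof (rule edge_equiv_if_tail_sums[OF assms(1) _ _ order_refl prems(2-5)])
      show "Suc k \<le> n" "k \<le> Suc k" using kn by auto
      show "c i > 0" if "i \<in> {1..k} \<union> {Suc (Suc k)..Suc k}" for i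
        using that prems(6)[of i] by auto
      show "fst (col m i) = fst (col m' i)" if "i \<in> {Suc k..Suc k}" for i
      proof -
        have "i = Suc k" using that by simp
        then show ?thesis using prems(4)[of i] prems(5)[of i] True by (simp add: col_size_def)
      qed
      show "tail_sums (\<Sum>i\<in>{1..k}. fst (col m i)) (\<Sum>i\<in>{Suc (Suc k)..Suc k}. fst (col m i)) (map (col m) [Suc (Suc k)..<Suc n]) =
         tail_sums (\<Sum>i\<in>{1..k}. fst (col m' i)) (\<Sum>i\<in>{Suc (Suc k)..Suc k}. fst (col m' i)) (map (col m') [Suc (Suc k)..<Suc n])"
        using tails by (simp del: upt_Suc)
    qed
  qed
qed

lemma edge_equiv_if_cyc_class:
  assumes "n \<ge> 3" "m \<in> monomials (bvars n)" "m' \<in> monomials (bvars n)" "cyc_class n m = cyc_class n m'"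
  shows "edge_equiv (K :: 'k::field itself) n (cycle_edges n) m m'"
proof (rule edge_equiv_if_cyc_sums[OF assms(1) _ assms(2,3), where k = 0])
  have sizes: "\<forall>i\<in>{1..n}. col_size (col m i) = col_size (col m' i)"
    using assms(4) by (auto simp: cyc_class_def simp del: upt_Suc)
  show "col_size (col m' i) = col_size (col m i)" for i
    using assms(2,3) sizes unfolding monomials_bvars_iff by (cases "i \<in> {1..n}") auto
  show "cyc_sums (\<Sum>i\<in>{1..0}. fst (col m i)) (map (col m) [Suc 0..<Suc n]) =
        cyc_sums (\<Sum>i\<in>{1..0}. fst (col m' i)) (map (col m') [Suc 0..<Suc n])"
    using assms(4) by (simp add: cyc_class_def del: upt_Suc)
qed auto

lemma monomial_classes_cycle:
  assumes "n \<ge> 3"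
  shows "monomial_classes (bvars n)
    (binomial_edge_ideal n (cycle_edges n) :: (bvar, 'k::field) mpoly set) (cyc_class n)"
proof (rule monomial_classes.intro)
  let ?I = "binomial_edge_ideal n (cycle_edges n) :: (bvar, 'k) mpoly set"
  show "ideal ?I (mpoly_ring (bvars n))" by (rule ideal_binomial_edge_ideal)
  show "lin (\<lambda>m. of_bool (cyc_class n m = \<kappa>)) p = 0" if p: "p \<in> ?I" for p \<kappa>
  proof (rule lin_eq_zero_on_genideal[OF edge_gens_carrier _ p[unfolded binomial_edge_ideal_def]])
    fix g :: "(bvar, 'k) mpoly" and u
    assume "g \<in> {mpoly_var (X i) * mpoly_var (Y j) - mpoly_var (X j) * mpoly_var (Y i) | i j.
      i \<in> {1..n} \<and> j \<in> {1..n} \<and> i < j \<and> {i, j} \<in> cycle_edges n}"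
    then obtain i j where g: "g = mpoly_var (X i) * mpoly_var (Y j) - mpoly_var (X j) * mpoly_var (Y i)"
      and ij: "i \<in> {1..n}" "j \<in> {1..n}" "i < j" "{i, j} \<in> cycle_edges n" by blast
    have "monom_of u * g = monom_of (u + (xvar i + yvar j)) - monom_of (u + (xvar j + yvar i))"
      by (simp add: g mpoly_var_def mult_single right_diff_distrib)
    then show "lin (\<lambda>m. of_bool (cyc_class n m = \<kappa>)) (monom_of u * g) = 0"
      using cyc_class_edge[OF ij, of u] by (simp add: lin_diff lin_simps)
  qed
  show "monom_of m - monom_of m' \<in> ?I"
    if "m \<in> monomials (bvars n)" "m' \<in> monomials (bvars n)" "cyc_class n m = cyc_class n m'" for m m'
    using edge_equiv_if_cyc_class[OF assms that] by (simp add: edge_equiv_def)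
  show "mono_degree m = mono_degree m'"
    if "m \<in> monomials (bvars n)" "m' \<in> monomials (bvars n)" "cyc_class n m = cyc_class n m'" for m m'
    using that by (simp add: mono_degree_eq_sum_list)
qed

text \<open>Fibred over the capacities, the classes become the sets counted by
  \<open>card_cyc_sums\<close>; the bound \<open>x \<le> 0\<close> is its instance
  \<open>s = 0\<close>.\<close>

lemma image_cyc_class:
  "cyc_class n ` {m \<in> monomials (bvars n). mono_degree m = d} =
     (SIGMA cs:compositions n d. {cyc_sums x ps | x ps. x \<le> 0 \<and> map col_size ps = cs})"
proof (intro equalityI subsetI)
  fix v assume "v \<in> cyc_class n ` {m \<in> monomials (bvars n). mono_degree m = d}"
  then obtain m where m: "m \<in> monomials (bvars n)" "mono_degree m = d" "v = cyc_class n m" by blast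
  have "fst v \<in> compositions n d"
    using m mono_degree_eq_sum_list[OF m(1)] by (simp add: compositions_def cyc_class_def del: upt_Suc)
  moreover have "snd v = cyc_sums 0 (map (col m) [1..<Suc n]) \<and> map col_size (map (col m) [1..<Suc n]) = fst v"
    by (simp add: m cyc_class_def comp_def del: upt_Suc)
  ultimately show "v \<in> (SIGMA cs:compositions n d. {cyc_sums x ps | x ps. x \<le> 0 \<and> map col_size ps = cs})"
    by (subst prod.collapse[symmetric]) blast
next
  fix v assume "v \<in> (SIGMA cs:compositions n d. {cyc_sums x ps | x ps. x \<le> 0 \<and> map col_size ps = cs})"
  then obtain ps where v: "v = (map col_size ps, cyc_sums 0 ps)" "map col_size ps \<in> compositions n d" by auto
  have len: "length ps = n" using v(2) by (simp add: compositions_def)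
  obtain m where m: "m \<in> monomials (bvars n)" "\<And>i. col m i = (if i \<in> {1..n} then ps ! (i - 1) else (0, 0))"
  proof -
    have "\<exists>m\<in>monomials (bvars n). \<forall>i. col m i = (if i \<in> {1..n} then ps ! (i - 1) else (0, 0))"
      by (rule ex_mono) auto
    then show ?thesis using that by blast
  qed
  have "map (col m) [1..<Suc n] = ps"
    using len by (intro nth_equalityI) (auto simp: m(2) simp del: upt_Suc)
  then have cls: "v = cyc_class n m"
    unfolding v(1) cyc_class_def by (metis (no_types, lifting) list.map_comp map_eq_conv comp_apply)
  moreover have "mono_degree m = d"
  proof -
    have "fst (cyc_class n m) = map col_size ps" using cls v(1) by (metis fst_conv)
    then show ?thesis
      using v(2) unfolding mono_degree_eq_sum_list[OF m(1)] by (simp add: compositions_def)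
  qed
  ultimately show "v \<in> cyc_class n ` {m \<in> monomials (bvars n). mono_degree m = d}"
    using m(1) by blast
qed

lemma card_image_cyc_class:
  "finite (cyc_class n ` {m \<in> monomials (bvars n). mono_degree m = d})"
  "card (cyc_class n ` {m \<in> monomials (bvars n). mono_degree m = d}) = (\<Sum>cs\<in>compositions n d. cyc_count 0 cs)"
  unfolding image_cyc_class using card_cyc_sums[of 0] finite_compositions[of n d]
  by (auto intro!: finite_SigmaI simp: card_SigmaI)

lemma hilbert_series_cycle:
  assumes "n \<ge> 3"
  shows "hilbert_series (bvars n) (binomial_edge_ideal n (cycle_edges n) :: (bvar, 'k::field) mpoly set) =
    list_gf n (cyc_count 0)"
proof -
  have "hilbert_function (bvars n) (binomial_edge_ideal n (cycle_edges n) :: (bvar, 'k) mpoly set) d =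
      (\<Sum>cs\<in>compositions n d. cyc_count 0 cs)" for d
    using monomial_classes.hilbert_function_eq[OF monomial_classes_cycle[OF assms] card_image_cyc_class(1)]
    unfolding card_image_cyc_class(2) .
  then show ?thesis by (simp add: hilbert_series_def list_gf_def)
qed

section \<open>Lengths of chains of primes\<close>

context monomial_classes
begin

text \<open>The normal forms of the \<open>p e\<close> lie in a span of at most
  \<open>card B\<close> representatives, so more than \<open>card B\<close> of them are dependent.
  Going back from normal forms to the \<open>p e\<close> changes the combination by an element of
  \<open>I\<close>.\<close>

lemma ex_combination_mem_ideal:
  assumes "finite F" "\<And>e. e \<in> F \<Longrightarrow> p e \<in> carrier (mpoly_ring V)"
    and "\<And>e. e \<in> F \<Longrightarrow> cls ` Poly_Mapping.keys (p e) \<subseteq> B"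
    and "finite B" "card B < card F"
  shows "\<exists>c. (\<exists>e\<in>F. c e \<noteq> 0) \<and> (\<Sum>e\<in>F. mpoly_const (c e) * p e) \<in> I"
proof -
  interpret vs: vector_space "\<lambda>c (p :: ('v, 'k) mpoly). mpoly_const c * p"
    by unfold_locales (simp_all add: mpoly_const_def ring_distribs single_add mult_single flip: mult.assoc)
  let ?N = "\<lambda>e. normal_form (p e)"
  let ?T = "(\<lambda>\<kappa>. monom_of (rep \<kappa>) :: ('v, 'k) mpoly) ` B"
  have span: "?N e \<in> vs.span ?T" if "e \<in> F" for e
  proof -
    have "?N e = (\<Sum>m\<in>Poly_Mapping.keys (p e).
        mpoly_const (Poly_Mapping.lookup (p e) m) * monom_of (rep (cls m)))"
      by (simp add: normal_form_def mpoly_const_def mult_single)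
    also have "\<dots> \<in> vs.span ?T"
      using assms(3)[OF that] by (intro vs.span_sum vs.span_scale vs.span_base) auto
    finally show ?thesis .
  qed
  have "\<exists>c. (\<exists>e\<in>F. c e \<noteq> 0) \<and> (\<Sum>e\<in>F. mpoly_const (c e) * ?N e) = 0"
  \<comment> \<open>Dependence is a property of the set of normal forms, so a coincidence of two of
    them is a separate case, with coefficients \<open>1\<close> and \<open>- 1\<close>.\<close>
  proof (cases "inj_on ?N F")
    case True
    have "vs.dependent (?N ` F)"
    proof (rule ccontr)
      assume "vs.independent (?N ` F)"
      then have "card (?N ` F) \<le> card ?T"
        using vs.independent_span_bound[of ?T "?N ` F"] span assms(4) by blast
      then show False using assms(4,5) card_image[OF True] card_image_le[of B] by (metis le_trans not_le)
    qed
    then obtain u where u: "\<exists>v\<in>?N ` F. u v \<noteq> 0" "(\<Sum>v\<in>?N ` F. mpoly_const (u v) * v) = 0"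
      using vs.dependent_finite[of "?N ` F"] assms(1) by auto
    then show ?thesis
      by (intro exI[of _ "\<lambda>e. u (?N e)"]) (auto simp: sum.reindex[OF True])
  next
    case False
    then obtain e e' where e: "e \<in> F" "e' \<in> F" "e \<noteq> e'" "?N e = ?N e'" by (auto simp: inj_on_def)
    let ?c = "\<lambda>x. if x = e then 1 else if x = e' then - 1 else 0 :: 'k"
    have "(\<Sum>x\<in>F. mpoly_const (?c x) * ?N x) = (\<Sum>x\<in>{e, e'}. mpoly_const (?c x) * ?N x)"
      using assms(1) e by (intro sum.mono_neutral_right) (auto simp: mpoly_const_def)
    also have "\<dots> = 0" using e by (simp add: mpoly_const_def single_uminus)
    finally show ?thesis using e(1) by (intro exI[of _ ?c]) auto
  qed
  then obtain c where c: "\<exists>e\<in>F. c e \<noteq> 0" "(\<Sum>e\<in>F. mpoly_const (c e) * ?N e) = 0" by blast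
  have "(\<Sum>e\<in>F. mpoly_const (c e) * p e) = (\<Sum>e\<in>F. mpoly_const (c e) * (p e - ?N e))"
    using c(2) by (simp add: right_diff_distrib sum_subtractf)
  also have "\<dots> \<in> I"
    using assms(2) by (intro ideal_mpoly_ring_sum[OF ideal] ideal_mpoly_ringD(5)[OF ideal] diff_normal_form)
      (auto simp: mpoly_const_def intro: carrier_closed)
  finally show ?thesis using c(1) by blast
qed

end

section \<open>Independence of power products along a chain of primes\<close>

lemma primeideal_mpoly_ringD:
  fixes P :: "('v, 'k::field) mpoly set"
  assumes "primeideal P (mpoly_ring V)"
  shows "ideal P (mpoly_ring V)" "1 \<notin> P"
    "\<And>p q. p \<in> carrier (mpoly_ring V) \<Longrightarrow> q \<in> carrier (mpoly_ring V) \<Longrightarrow> p * q \<in> P \<Longrightarrow> p \<in> P \<or> q \<in> P"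
proof -
  interpret primeideal P "mpoly_ring V :: ('v, 'k) mpoly ring" by fact
  show "ideal P (mpoly_ring V)" by (rule is_ideal)
  show "1 \<notin> P" using one_imp_carrier I_notcarr by auto
  show "p \<in> P \<or> q \<in> P" if "p \<in> carrier (mpoly_ring V)" "q \<in> carrier (mpoly_ring V)" "p * q \<in> P" for p q
    using I_prime[OF that(1,2)] that(3) by simp
qed

definition power_product :: "'a::comm_monoid_mult list \<Rightarrow> nat list \<Rightarrow> 'a" where
  "power_product fs es = prod_list (map2 (^) fs es)"

lemma carrier_power: "p \<in> carrier (mpoly_ring V) \<Longrightarrow> p ^ k \<in> carrier (mpoly_ring V)"
  for p :: "('v, 'k::field) mpoly"
  by (induction k) (auto intro: carrier_closed)

lemma carrier_power_product:
  assumes "set fs \<subseteq> carrier (mpoly_ring V :: ('v, 'k::field) mpoly ring)"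
  shows "power_product fs es \<in> carrier (mpoly_ring V)"
  using assms
proof (induction fs arbitrary: es)
  case (Cons f fs)
  then show ?case
    by (cases es) (auto simp: power_product_def intro: carrier_closed carrier_power)
qed (simp add: power_product_def carrier_closed)

lemma carrier_mpoly_const: "mpoly_const c \<in> carrier (mpoly_ring V)"
  by (simp add: mpoly_const_def carrier_closed)

text \<open>If \<open>\<Sum>j<m. f^j g j\<close> lies in the smaller prime \<open>P\<close>, then \<open>g 0\<close> lies in \<open>P'\<close>, hence vanishes, and
  \<open>f\<close> can be cancelled because it is outside \<open>P\<close>.\<close>

lemma coefficients_eq_zero_between_primes:
  fixes P P' :: "('v, 'k::field) mpoly set"
  assumes P: "primeideal P (mpoly_ring V)" and P': "ideal P' (mpoly_ring V)"
    and "P \<subseteq> P'" "f \<in> P'" "f \<notin> P"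
    and "\<And>j. g j \<in> carrier (mpoly_ring V)" "\<And>j. j < m \<Longrightarrow> g j \<in> P' \<Longrightarrow> g j = 0"
    and "(\<Sum>j<m. f ^ j * g j) \<in> P" "j < m"
  shows "g j = 0"
  using assms(6-)
proof (induction m arbitrary: g j)
  case (Suc m)
  have f: "f \<in> carrier (mpoly_ring V)" using assms(4) ideal_mpoly_ringD(1)[OF P'] by blast
  let ?s = "\<Sum>j<m. f ^ j * g (Suc j)"
  have s: "?s \<in> carrier (mpoly_ring V)"
    using f Suc.prems(1) by (intro carrier_sum carrier_closed carrier_power) auto
  have split: "(\<Sum>j<Suc m. f ^ j * g j) = g 0 + f * ?s"
    by (simp only: sum.lessThan_Suc_shift) (simp add: sum_distrib_left mult.assoc)
  have "s * f \<in> P'" if "s \<in> carrier (mpoly_ring V)" for s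
    using ideal_mpoly_ringD(5)[OF P' assms(4) that] .
  then have "g 0 + f * ?s - ?s * f \<in> P'"
    using Suc.prems(3) s assms(3) unfolding split by (intro ideal_mpoly_ringD(4)[OF P']) auto
  then have "g 0 = 0" using Suc.prems(2)[of 0] by (simp add: mult.commute)
  then have "f * ?s \<in> P" using Suc.prems(3) unfolding split by simp
  then have sP: "?s \<in> P" using primeideal_mpoly_ringD(3)[OF P f s] assms(5) by blast
  show ?case
  proof (cases j)
    case 0
    then show ?thesis using \<open>g 0 = 0\<close> by simp
  next
    case (Suc i)
    have "g (Suc i) = 0"
      by (rule Suc.IH[of "\<lambda>j. g (Suc j)"]) (use Suc.prems sP Suc in auto)
    then show ?thesis using Suc by simp
  qed
qed simp

text \<open>Collect the sum by powers of the first element \<open>f\<close>, with coefficients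
  \<open>g j\<close> in the remaining elements. The induction hypothesis for the chain shifted by
  one says that \<open>g j \<in> P 1\<close> kills all coefficients of \<open>g j\<close>, which is
  the condition under which powers of \<open>f\<close> can be peeled off modulo \<open>P 0\<close>.
  In the base case a nonzero constant would be a unit in a prime.\<close>

lemma power_products_independent:
  fixes P :: "nat \<Rightarrow> ('v, 'k::field) mpoly set"
  assumes "\<And>i. i \<le> length fs \<Longrightarrow> primeideal (P i) (mpoly_ring V)"
    and "\<And>i. i < length fs \<Longrightarrow> P i \<subseteq> P (Suc i) \<and> fs ! i \<in> P (Suc i) - P i"
    and "(\<Sum>es\<in>{es. set es \<subseteq> {..<m} \<and> length es = length fs}. mpoly_const (c es) * power_product fs es) \<in> P 0"
    and "set es \<subseteq> {..<m}" "length es = length fs"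
  shows "c es = 0"
  using assms
proof (induction fs arbitrary: P c es)
  case Nil
  have P: "primeideal (P 0) (mpoly_ring V)" using Nil.prems(1) by simp
  have "{es. set es \<subseteq> {..<m} \<and> length es = length []} = {[]}" by auto
  then have c: "mpoly_const (c []) \<in> P 0" using Nil.prems(3) by (simp add: power_product_def)
  have "c [] = 0"
  proof (rule ccontr)
    assume "c [] \<noteq> 0"
    then have "mpoly_const (inverse (c [])) * mpoly_const (c []) = (1 :: ('v, 'k) mpoly)"
      by (simp add: mpoly_const_def mult_single)
    then show False
      using ideal_mpoly_ringD(5)[OF primeideal_mpoly_ringD(1)[OF P] c carrier_mpoly_const]
        primeideal_mpoly_ringD(2)[OF P] by metis
  qed
  then show ?case using Nil.prems(5) by simp
next
  case (Cons f fs)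
  let ?E = "{es. set es \<subseteq> {..<m} \<and> length es = length fs}"
  define g where "g j = (\<Sum>es\<in>?E. mpoly_const (c (j # es)) * power_product fs es)" for j
  have prime: "primeideal (P i) (mpoly_ring V)" if "i \<le> Suc (length fs)" for i
    using Cons.prems(1) that by simp
  have step: "P i \<subseteq> P (Suc i) \<and> (f # fs) ! i \<in> P (Suc i) - P i" if "i < Suc (length fs)" for i
    using Cons.prems(2)[of i] that by simp
  have ideal1: "ideal (P 1) (mpoly_ring V)" using primeideal_mpoly_ringD(1)[OF prime] by simp
  have "fs ! i \<in> carrier (mpoly_ring V)" if "i < length fs" for i
    using step[of "Suc i"] that ideal_mpoly_ringD(1)[OF primeideal_mpoly_ringD(1)[OF prime, of "Suc (Suc i)"]]
    by auto
  then have fs: "set fs \<subseteq> carrier (mpoly_ring V)" by (auto simp: set_conv_nth)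
  have IH: "c (j # es) = 0" if "g j \<in> P 1" "es \<in> ?E" for j es
    by (rule Cons.IH[of "\<lambda>i. P (Suc i)" "\<lambda>es. c (j # es)" es])
       (use prime step[of "Suc _"] that in \<open>auto simp: g_def\<close>)
  have "{es. set es \<subseteq> {..<m} \<and> length es = length (f # fs)} = (\<lambda>(j, es). j # es) ` ({..<m} \<times> ?E)"
    by (auto simp: length_Suc_conv image_iff)
  moreover have "inj_on (\<lambda>(j, es). j # es) ({..<m} \<times> ?E)" by (auto simp: inj_on_def)
  ultimately have "(\<Sum>es\<in>{es. set es \<subseteq> {..<m} \<and> length es = length (f # fs)}. mpoly_const (c es) * power_product (f # fs) es)
      = (\<Sum>(j, es)\<in>{..<m} \<times> ?E. mpoly_const (c (j # es)) * power_product (f # fs) (j # es))"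
    by (simp add: sum.reindex case_prod_unfold)
  also have "\<dots> = (\<Sum>j<m. \<Sum>es\<in>?E. mpoly_const (c (j # es)) * power_product (f # fs) (j # es))"
    by (rule sum.cartesian_product[symmetric])
  also have "\<dots> = (\<Sum>j<m. f ^ j * g j)"
    by (simp add: g_def sum_distrib_left power_product_def mult_ac)
  finally have sum: "(\<Sum>j<m. f ^ j * g j) \<in> P 0" using Cons.prems(3) by simp
  obtain j es' where es: "es = j # es'" "j < m" "es' \<in> ?E"
    using Cons.prems(4,5) by (cases es) auto
  have "g j = 0"
  proof (rule coefficients_eq_zero_between_primes[OF prime ideal1 _ _ _ _ _ sum es(2)])
    show "P 0 \<subseteq> P 1" "f \<in> P 1" "f \<notin> P 0" using step[of 0] by auto
    show "g j \<in> carrier (mpoly_ring V)" for j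
      unfolding g_def by (intro carrier_sum carrier_closed carrier_mpoly_const carrier_power_product fs)
    show "g j = 0" if "g j \<in> P 1" for j
      unfolding g_def using IH[OF that] by (intro sum.neutral) (auto simp: mpoly_const_def)
  qed simp
  \<comment> \<open>From \<open>g j = 0\<close> as a polynomial back to its coefficients: zero lies
    in \<open>P 1\<close>, so the induction hypothesis applies once more.\<close>
  then have "g j \<in> P 1" using ideal_mpoly_ringD(2)[OF ideal1] by simp
  then show ?case using IH es by simp
qed

section \<open>Degree bounds and growth rates\<close>

lemma mono_degree_add: "mono_degree (m + m') = mono_degree m + mono_degree m'"
  using extend_sum_add[of "\<lambda>_ a. a" m m'] by (simp add: mono_degree_def extend_sum_def)

definition degree_le :: "nat \<Rightarrow> ('v, 'k::field) mpoly \<Rightarrow> bool" where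
  "degree_le D p \<longleftrightarrow> (\<forall>m\<in>Poly_Mapping.keys p. mono_degree m \<le> D)"

lemma degree_le_mult: "degree_le D p \<Longrightarrow> degree_le D' q \<Longrightarrow> degree_le (D + D') (p * q)"
  unfolding degree_le_def using keys_mult[of p q] by (fastforce simp: mono_degree_add intro: add_mono)

lemma degree_le_one: "degree_le D 1"
  by (simp add: degree_le_def mono_degree_def)

lemma degree_le_power: "degree_le D p \<Longrightarrow> degree_le (D * k) (p ^ k)"
  by (induction k) (auto simp: degree_le_one dest: degree_le_mult)

lemma degree_le_mono: "degree_le D p \<Longrightarrow> D \<le> D' \<Longrightarrow> degree_le D' p"
  by (auto simp: degree_le_def)

lemma degree_le_power_product:
  assumes "\<And>f. f \<in> set fs \<Longrightarrow> degree_le a f" "set es \<subseteq> {..<m}"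
  shows "degree_le (a * m * length fs) (power_product fs es)"
  using assms
proof (induction fs arbitrary: es)
  case (Cons f fs)
  show ?case
  proof (cases es)
    case (Cons e es')
    have "degree_le (a * m) (f ^ e)"
      using degree_le_power[of a f e] Cons.prems \<open>es = _\<close> by (auto intro: degree_le_mono)
    then have "degree_le (a * m + a * m * length fs) (f ^ e * power_product fs es')"
      using Cons.IH[of es'] Cons.prems \<open>es = _\<close> by (intro degree_le_mult) auto
    then show ?thesis by (simp add: power_product_def \<open>es = _\<close>)
  qed (simp add: power_product_def degree_le_one)
qed (simp add: power_product_def degree_le_one)

lemma ex_degree_le: "finite A \<Longrightarrow> \<exists>D. \<forall>p\<in>A. degree_le D p"
proof (induction A rule: finite_induct)
  case (insert p A)
  then obtain D where D: "\<forall>p\<in>A. degree_le D p" by blast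
  have "degree_le (Max (insert 0 (mono_degree ` Poly_Mapping.keys p))) p" by (simp add: degree_le_def)
  then show ?case using D
    by (intro exI[of _ "max D (Max (insert 0 (mono_degree ` Poly_Mapping.keys p)))"])
       (auto intro: degree_le_mono)
qed simp

lemma fps_nth_sum_if_one_minus_X_mult:
  assumes "(1 - fps_X) * g = (f :: 'a::comm_ring_1 fps)"
  shows "fps_nth g d = (\<Sum>i\<le>d. fps_nth f i)"
proof (induction d)
  case 0
  show ?case by (simp flip: assms add: left_diff_distrib)
next
  case (Suc d)
  have "fps_nth f (Suc d) = fps_nth g (Suc d) - fps_nth g d" by (simp flip: assms add: left_diff_distrib)
  then show ?case using Suc by simp
qed

text \<open>Division by \<open>1 - fps_X\<close> replaces coefficients by their partial sums, and
  summing once more costs a factor \<open>d + 1\<close>. For a polynomial the partial sums are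
  bounded by the sum of the absolute values of its coefficients.\<close>

lemma coeff_sum_growth:
  fixes h :: "rat poly"
  shows "\<exists>C. \<forall>d. \<bar>\<Sum>i\<le>d. fps_nth (fps_of_poly h / (1 - fps_X) ^ k) i\<bar> \<le> C * of_nat (d + 1) ^ k"
proof (induction k)
  case 0
  have "\<bar>\<Sum>i\<le>d. coeff h i\<bar> \<le> (\<Sum>i\<le>degree h. \<bar>coeff h i\<bar>)" for d
  proof -
    have "\<bar>\<Sum>i\<le>d. coeff h i\<bar> \<le> (\<Sum>i\<le>d. \<bar>coeff h i\<bar>)" by (rule sum_abs)
    also have "\<dots> = (\<Sum>i\<in>{..d} \<inter> {..degree h}. \<bar>coeff h i\<bar>)"
      by (rule sum.mono_neutral_right) (auto intro: le_degree)
    also have "\<dots> \<le> (\<Sum>i\<le>degree h. \<bar>coeff h i\<bar>)" by (rule sum_mono2) auto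
    finally show ?thesis .
  qed
  then show ?case by auto
next
  case (Suc k)
  let ?g = "\<lambda>k. fps_of_poly h / (1 - fps_X) ^ k"
  from Suc obtain C where C: "\<bar>\<Sum>i\<le>d. fps_nth (?g k) i\<bar> \<le> C * of_nat (d + 1) ^ k" for d by blast
  have "(1 - fps_X) ^ k * ((1 - fps_X) * ?g (Suc k)) = (1 - fps_X) ^ Suc k * ?g (Suc k)" by (simp add: mult_ac)
  also have "\<dots> = fps_of_poly h" by (subst fps_div_one_minus_X_iff[symmetric]) (rule refl)
  finally have "(1 - fps_X) * ?g (Suc k) = ?g k" by (subst fps_div_one_minus_X_iff)
  from fps_nth_sum_if_one_minus_X_mult[OF this]
  have nth: "fps_nth (?g (Suc k)) d = (\<Sum>i\<le>d. fps_nth (?g k) i)" for d .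
  have C0: "C \<ge> 0" using order_trans[OF abs_ge_zero C[of 0]] by simp
  have "\<bar>\<Sum>i\<le>d. fps_nth (?g (Suc k)) i\<bar> \<le> C * of_nat (d + 1) ^ Suc k" for d
  proof -
    have "\<bar>\<Sum>i\<le>d. fps_nth (?g (Suc k)) i\<bar> \<le> (\<Sum>i\<le>d. \<bar>fps_nth (?g (Suc k)) i\<bar>)" by (rule sum_abs)
    also have "\<dots> \<le> (\<Sum>i\<le>d. C * of_nat (d + 1) ^ k)"
    proof (rule sum_mono)
      fix i assume "i \<in> {..d}"
      then have "(of_nat (i + 1) :: rat) ^ k \<le> of_nat (d + 1) ^ k" by (intro power_mono) auto
      then show "\<bar>fps_nth (?g (Suc k)) i\<bar> \<le> C * of_nat (d + 1) ^ k"
        unfolding nth using C[of i] C0 by (meson mult_left_mono order_trans)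
    qed
    finally show ?thesis by (simp add: mult_ac)
  qed
  then show ?case by blast
qed

text \<open>Since \<open>a * Suc m + 1 \<le> (a + 1) * Suc m\<close>, the right side is at most a
  constant times \<open>Suc m ^ k\<close>; for \<open>l > k\<close> any \<open>m\<close> beyond that
  constant contradicts the bound. The absolute value covers a negative \<open>C\<close>.\<close>

lemma power_growth_contradiction:
  fixes C :: rat
  assumes "\<And>m. of_nat (Suc m) ^ l \<le> C * of_nat (a * Suc m + 1) ^ k"
  shows "l \<le> k"
proof (rule ccontr)
  assume "\<not> l \<le> k"
  then obtain j where j: "l = k + Suc j" by (metis add_Suc_right less_iff_Suc_add not_le)
  obtain m :: nat where m: "of_nat m > \<bar>C\<bar> * of_nat (a + 1) ^ k" using reals_Archimedean2 by blast
  let ?x = "of_nat (Suc m) :: rat"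
  have "C * of_nat (a * Suc m + 1) ^ k \<le> \<bar>C\<bar> * of_nat ((a + 1) * Suc m) ^ k"
    by (intro mult_mono power_mono) auto
  also have "\<dots> = (\<bar>C\<bar> * of_nat (a + 1) ^ k) * ?x ^ k" by (simp only: of_nat_mult power_mult_distrib mult.assoc)
  also have "\<dots> < ?x * ?x ^ k"
    using m by (intro mult_strict_right_mono) auto
  also have "\<dots> = ?x ^ Suc k" by simp
  also have "\<dots> \<le> ?x ^ l" by (rule power_increasing) (auto simp: j)
  finally show False using assms[of m] by simp
qed

text \<open>If the \<open>Suc m ^ l\<close> power products outnumbered the classes up to the degree
  they can reach, a nontrivial combination of them would lie in \<open>I\<close>, hence in
  \<open>P 0\<close>, against independence. So \<open>Suc m ^ l\<close> is bounded by a sum of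
  Hilbert function values, whose growth has exponent \<open>k\<close>.\<close>

lemma prime_chain_length_le:
  fixes I :: "(bvar, 'k::field) mpoly set"
  assumes n: "n \<ge> 3" and I: "I = binomial_edge_ideal n (cycle_edges n)"
    and hs: "hilbert_series (bvars n) I = fps_of_poly h / (1 - fps_X) ^ k"
    and prime: "\<And>i. i \<le> l \<Longrightarrow> primeideal (P i) (mpoly_ring (bvars n))"
    and strict: "\<And>i. i < l \<Longrightarrow> P i \<subset> P (Suc i)" and "I \<subseteq> P 0"
  shows "l \<le> k"
proof -
  interpret monomial_classes "bvars n" I "cyc_class n" unfolding I by (rule monomial_classes_cycle[OF n])
  have "\<exists>f. f \<in> P (Suc i) - P i" if "i < l" for i using strict[OF that] by blast
  then obtain f where f: "\<And>i. i < l \<Longrightarrow> f i \<in> P (Suc i) - P i" by metis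
  define fs where "fs = map f [0..<l]"
  have len: "length fs = l" and nth: "\<And>i. i < l \<Longrightarrow> fs ! i = f i" by (simp_all add: fs_def)
  obtain a where a: "\<forall>p\<in>set fs. degree_le a p" using ex_degree_le[of "set fs"] by auto
  have fs: "set fs \<subseteq> carrier (mpoly_ring (bvars n))"
  proof
    fix p assume "p \<in> set fs"
    then obtain i where i: "i < l" "p = f i" by (auto simp: fs_def)
    have "P (Suc i) \<subseteq> carrier (mpoly_ring (bvars n))"
      using i by (intro ideal_mpoly_ringD(1) primeideal_mpoly_ringD(1) prime) auto
    then show "p \<in> carrier (mpoly_ring (bvars n))" using f[OF i(1)] i(2) by blast
  qed
  obtain C where C: "\<And>d. \<bar>\<Sum>i\<le>d. fps_nth (fps_of_poly h / (1 - fps_X) ^ k) i\<bar> \<le> C * of_nat (d + 1) ^ k"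
    using coeff_sum_growth by blast
  let ?mon = "\<lambda>d. {m \<in> monomials (bvars n). mono_degree m = d}"
  show ?thesis
  proof (rule power_growth_contradiction)
    fix m
    \<comment> \<open>There are \<open>l\<close> factors, each a power with exponent below
      \<open>Suc m\<close> of an element of degree at most \<open>a\<close>.\<close>
    let ?D = "a * Suc m * l"
    let ?E = "{es. set es \<subseteq> {..<Suc m} \<and> length es = length fs}"
    let ?B = "\<Union>d\<le>?D. cyc_class n ` ?mon d"
    have E: "finite ?E" "card ?E = Suc m ^ l"
      using finite_lists_length_eq[of "{..<Suc m}" l] card_lists_length_eq[of "{..<Suc m}" l] by (simp_all add: len)
    have finB: "finite ?B" using card_image_cyc_class(1) by blast
    have "card ?E \<le> card ?B"
    proof (rule ccontr)
      assume "\<not> card ?E \<le> card ?B"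
      then have less: "card ?B < card ?E" by simp
      have "\<exists>c. (\<exists>es\<in>?E. c es \<noteq> 0) \<and> (\<Sum>es\<in>?E. mpoly_const (c es) * power_product fs es) \<in> I"
      proof (rule ex_combination_mem_ideal[OF E(1) _ _ finB less])
        fix es assume es: "es \<in> ?E"
        show carr: "power_product fs es \<in> carrier (mpoly_ring (bvars n))" by (rule carrier_power_product[OF fs])
        have "degree_le ?D (power_product fs es)"
          using degree_le_power_product[of fs a es "Suc m"] a es len by auto
        then show "cyc_class n ` Poly_Mapping.keys (power_product fs es) \<subseteq> ?B"
          using carr unfolding degree_le_def carrier_mpoly_ring by blast
      qed
      then obtain c where c: "\<exists>es\<in>?E. c es \<noteq> 0" "(\<Sum>es\<in>?E. mpoly_const (c es) * power_product fs es) \<in> P 0"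
        using \<open>I \<subseteq> P 0\<close> by blast
      have "c es = 0" if "es \<in> ?E" for es
      proof (rule power_products_independent[where fs = fs and m = "Suc m" and P = P and c = c and V = "bvars n"])
        show "primeideal (P i) (mpoly_ring (bvars n))" if "i \<le> length fs" for i
          using prime that len by simp
        show "P i \<subseteq> P (Suc i) \<and> fs ! i \<in> P (Suc i) - P i" if "i < length fs" for i
          using strict[of i] f[of i] nth[of i] that len by auto
      qed (use that c(2) in auto)
      then show False using c(1) by blast
    qed
    also have "card ?B \<le> (\<Sum>d\<le>?D. card (cyc_class n ` ?mon d))" by (rule card_UN_le) simp
    also have "\<dots> = (\<Sum>d\<le>?D. hilbert_function (bvars n) I d)"
      by (simp only: hilbert_function_eq[OF card_image_cyc_class(1)])
    finally have "rat_of_nat (Suc m ^ l) \<le> of_nat (\<Sum>d\<le>?D. hilbert_function (bvars n) I d)"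
      unfolding E(2) by (rule of_nat_mono)
    also have "\<dots> = (\<Sum>d\<le>?D. fps_nth (fps_of_poly h / (1 - fps_X) ^ k) d)"
      unfolding hs[symmetric] by (simp add: hilbert_series_def)
    also have "\<dots> \<le> C * of_nat (?D + 1) ^ k" using C[of ?D] by linarith
    finally show "of_nat (Suc m) ^ l \<le> C * of_nat ((a * l) * Suc m + 1) ^ k"
      by (simp only: of_nat_power mult_ac)
  qed
qed

section \<open>Krull dimension and multiplicity\<close>

lemma primeideal_quot_vimage:
  fixes I :: "('v, 'k::field) mpoly set"
  assumes I: "ideal I (mpoly_ring V)" and P: "primeideal P (mpoly_ring V Quot I)"
  defines "P' \<equiv> {r \<in> carrier (mpoly_ring V). I +>\<^bsub>mpoly_ring V\<^esub> r \<in> P}"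
  shows "primeideal P' (mpoly_ring V)" "I \<subseteq> P'"
proof -
  interpret hom: ring_hom_ring "mpoly_ring V" "mpoly_ring V Quot I" "(+>\<^bsub>mpoly_ring V\<^esub>) I"
    by (rule ideal.rcos_ring_hom_ring[OF I])
  interpret P: primeideal P "mpoly_ring V Quot I" by (rule P)
  show "primeideal P' (mpoly_ring V)"
  proof (rule primeidealI)
    show "ideal P' (mpoly_ring V)" unfolding P'_def by (rule hom.ideal_vimage[OF P.is_ideal])
    show "cring (mpoly_ring V :: ('v, 'k) mpoly ring)" by (rule mpoly_ring_cring)
    show "carrier (mpoly_ring V) \<noteq> P'"
    proof
      assume "carrier (mpoly_ring V) = P'"
      then have "\<one>\<^bsub>mpoly_ring V\<^esub> \<in> P'" using hom.R.one_closed by blast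
      then have "\<one>\<^bsub>mpoly_ring V Quot I\<^esub> \<in> P"
        unfolding P'_def mem_Collect_eq hom.hom_one by blast
      then show False using P.one_imp_carrier P.I_notcarr by simp
    qed
    show "a \<in> P' \<or> b \<in> P'" if "a \<in> carrier (mpoly_ring V)" "b \<in> carrier (mpoly_ring V)"
      "a \<otimes>\<^bsub>mpoly_ring V\<^esub> b \<in> P'" for a b
      using that P.I_prime[of "I +>\<^bsub>mpoly_ring V\<^esub> a" "I +>\<^bsub>mpoly_ring V\<^esub> b"]
        hom.hom_mult[OF that(1,2)] by (auto simp: P'_def)
  qed
  show "I \<subseteq> P'"
  proof
    fix p assume p: "p \<in> I"
    have "I +>\<^bsub>mpoly_ring V\<^esub> p = \<zero>\<^bsub>mpoly_ring V Quot I\<^esub>"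
      using ring.a_rcos_zero[OF mpoly_ring_ring I p] by (simp add: FactRing_def)
    then show "p \<in> P'"
      using p ideal_mpoly_ringD(1)[OF I] additive_subgroup.zero_closed[OF P.is_additive_subgroup]
      by (auto simp: P'_def)
  qed
qed

text \<open>As \<open>I \<subseteq> P\<close>, membership in \<open>P\<close> depends only on the
  coset. This gives primality of the image and later keeps inclusions of images strict.\<close>

lemma primeideal_quot_image:
  fixes I :: "('v, 'k::field) mpoly set"
  assumes I: "ideal I (mpoly_ring V)" and P: "primeideal P (mpoly_ring V)" and "I \<subseteq> P"
  shows "primeideal ((+>\<^bsub>mpoly_ring V\<^esub>) I ` P) (mpoly_ring V Quot I)"
    and "p \<in> carrier (mpoly_ring V) \<Longrightarrow> I +>\<^bsub>mpoly_ring V\<^esub> p \<in> (+>\<^bsub>mpoly_ring V\<^esub>) I ` P \<longleftrightarrow> p \<in> P"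
proof -
  let ?h = "(+>\<^bsub>mpoly_ring V\<^esub>) I"
  interpret hom: ring_hom_ring "mpoly_ring V" "mpoly_ring V Quot I" ?h
    by (rule ideal.rcos_ring_hom_ring[OF I])
  note PD = primeideal_mpoly_ringD[OF P]
  show mem: "?h p \<in> ?h ` P \<longleftrightarrow> p \<in> P" if p: "p \<in> carrier (mpoly_ring V)" for p
  proof
    assume "?h p \<in> ?h ` P"
    then obtain q where q: "q \<in> P" "?h p = ?h q" by blast
    have qc: "q \<in> carrier (mpoly_ring V)" using q(1) ideal_mpoly_ringD(1)[OF PD(1)] by blast
    have "p - q \<in> I"
      using ring.quotient_eq_iff_same_a_r_cos[OF mpoly_ring_ring I p qc] q(2)
      by (simp add: mpoly_ring_a_minus[OF p qc])
    then have "(p - q) + q \<in> P" using assms(3) q(1) by (intro ideal_mpoly_ringD(3)[OF PD(1)]) auto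
    then show "p \<in> P" by simp
  qed blast
  have carr: "\<exists>a\<in>carrier (mpoly_ring V). x = ?h a" if "x \<in> carrier (mpoly_ring V Quot I)" for x
    using that by (auto simp: FactRing_def A_RCOSETS_def')
  show "primeideal (?h ` P) (mpoly_ring V Quot I)"
  proof (rule primeidealI)
    show "ideal (?h ` P) (mpoly_ring V Quot I)"
      by (rule ring.ring_ideal_imp_quot_ideal[OF mpoly_ring_ring I PD(1)])
    show "cring (mpoly_ring V Quot I)"
      by (rule ideal.quotient_is_cring[OF I mpoly_ring_cring])
    have one: "(1 :: ('v, 'k) mpoly) \<in> carrier (mpoly_ring V)" by (rule carrier_closed)
    then have "?h 1 \<notin> ?h ` P" using mem PD(2) by blast
    moreover have "?h 1 \<in> carrier (mpoly_ring V Quot I)" using one by (rule hom.hom_closed)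
    ultimately show "carrier (mpoly_ring V Quot I) \<noteq> ?h ` P" by blast
    fix x y assume xy: "x \<in> carrier (mpoly_ring V Quot I)" "y \<in> carrier (mpoly_ring V Quot I)"
      "x \<otimes>\<^bsub>mpoly_ring V Quot I\<^esub> y \<in> ?h ` P"
    obtain a b where ab: "a \<in> carrier (mpoly_ring V)" "x = ?h a" "b \<in> carrier (mpoly_ring V)" "y = ?h b"
      using carr xy(1,2) by blast
    then have "?h (a * b) \<in> ?h ` P" using xy(3) hom.hom_mult[OF ab(1,3)] by simp
    then have "a * b \<in> P" using mem[OF carrier_closed(6)[OF ab(1,3)]] by blast
    then show "x \<in> ?h ` P \<or> y \<in> ?h ` P" using PD(3)[OF ab(1,3)] ab by blast
  qed
qed

lemma krull_dim_quot_eqI: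
  fixes I :: "('v, 'k::field) mpoly set"
  assumes I: "ideal I (mpoly_ring V)"
    and upper: "\<And>l P. (\<And>i. i \<le> l \<Longrightarrow> primeideal (P i) (mpoly_ring V)) \<Longrightarrow>
      (\<And>i. i < l \<Longrightarrow> P i \<subset> P (Suc i)) \<Longrightarrow> I \<subseteq> P 0 \<Longrightarrow> l \<le> d"
    and lower: "\<And>i. i \<le> d \<Longrightarrow> primeideal (P i) (mpoly_ring V)"
      "\<And>i. i < d \<Longrightarrow> P i \<subset> P (Suc i)" "\<And>i. i \<le> d \<Longrightarrow> I \<subseteq> P i"
  shows "krull_dim (mpoly_ring V Quot I) = enat d"
  unfolding krull_dim_def
proof (rule antisym)
  let ?h = "(+>\<^bsub>mpoly_ring V\<^esub>) I"
  let ?chains = "{enat l | l. \<exists>P. (\<forall>i\<le>l. primeideal (P i) (mpoly_ring V Quot I)) \<and> (\<forall>i<l. P i \<subset> P (Suc i))}"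
  show "Sup ?chains \<le> enat d"
  proof (rule Sup_least)
    fix x assume "x \<in> ?chains"
    then obtain l P where x: "x = enat l" and P: "\<And>i. i \<le> l \<Longrightarrow> primeideal (P i) (mpoly_ring V Quot I)"
      and strict: "\<And>i. i < l \<Longrightarrow> P i \<subset> P (Suc i)" by blast
    let ?P = "\<lambda>i. {r \<in> carrier (mpoly_ring V). ?h r \<in> P i}"
    have "l \<le> d"
    proof (rule upper)
      show "primeideal (?P i) (mpoly_ring V)" if "i \<le> l" for i
        by (rule primeideal_quot_vimage(1)[OF I P[OF that]])
      show "I \<subseteq> ?P 0" by (rule primeideal_quot_vimage(2)[OF I P]) simp
      show "?P i \<subset> ?P (Suc i)" if i: "i < l" for i
      proof -
        obtain c where c: "c \<in> P (Suc i)" "c \<notin> P i" using strict[OF i] by blast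
        interpret P: primeideal "P (Suc i)" "mpoly_ring V Quot I" using P i by simp
        have "c \<in> carrier (mpoly_ring V Quot I)" using c(1) P.a_subset by blast
        \<comment> \<open>The coset map is onto, so a witness of strictness in the quotient lifts to
          the polynomial ring.\<close>
        then obtain r where "r \<in> carrier (mpoly_ring V)" "c = ?h r"
          by (auto simp: FactRing_def A_RCOSETS_def')
        then show ?thesis using c strict[OF i] by blast
      qed
    qed
    then show "x \<le> enat d" by (simp add: x)
  qed
  have "(\<forall>i\<le>d. primeideal (?h ` P i) (mpoly_ring V Quot I)) \<and> (\<forall>i<d. ?h ` P i \<subset> ?h ` P (Suc i))"
  proof (intro conjI allI impI)
    fix i assume "i \<le> d"
    then show "primeideal (?h ` P i) (mpoly_ring V Quot I)" by (intro primeideal_quot_image(1) I lower)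
  next
    fix i assume i: "i < d"
    then obtain p where p: "p \<in> P (Suc i)" "p \<notin> P i" using lower(2) by blast
    have "P (Suc i) \<subseteq> carrier (mpoly_ring V)"
      using i by (intro ideal_mpoly_ringD(1) primeideal_mpoly_ringD(1) lower(1)) simp
    then have "?h p \<notin> ?h ` P i"
      using primeideal_quot_image(2)[OF I lower(1)[of i] lower(3)[of i], of p] p i by auto
    then show "?h ` P i \<subset> ?h ` P (Suc i)" using lower(2)[OF i] p(1) by blast
  qed
  then have "enat d \<in> ?chains"
    unfolding mem_Collect_eq by (intro exI[of _ d] conjI refl) (rule exI[of _ "\<lambda>i. ?h ` P i"])
  then show "enat d \<le> Sup ?chains" by (rule Sup_upper)
qed

section \<open>Evaluation homomorphisms and a chain of kernels\<close>

definition eval_mono :: "('v \<Rightarrow> 'b::comm_monoid_mult) \<Rightarrow> ('v \<Rightarrow>\<^sub>0 nat) \<Rightarrow> 'b" where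
  "eval_mono \<phi> m = (\<Prod>v\<in>Poly_Mapping.keys m. \<phi> v ^ Poly_Mapping.lookup m v)"

lemma eval_mono_superset:
  assumes "finite A" "Poly_Mapping.keys m \<subseteq> A"
  shows "eval_mono \<phi> m = (\<Prod>v\<in>A. \<phi> v ^ Poly_Mapping.lookup m v)"
  unfolding eval_mono_def using assms by (intro prod.mono_neutral_left) (auto simp: in_keys_iff)

lemma eval_mono_add: "eval_mono \<phi> (m + m') = eval_mono \<phi> m * eval_mono \<phi> m'"
proof -
  let ?A = "Poly_Mapping.keys m \<union> Poly_Mapping.keys m'"
  have "eval_mono \<phi> r = (\<Prod>v\<in>?A. \<phi> v ^ Poly_Mapping.lookup r v)" if "Poly_Mapping.keys r \<subseteq> ?A" for r
    using that by (intro eval_mono_superset) auto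
  from this[of m] this[of m'] this[of "m + m'"] show ?thesis
    by (simp add: keys_plus_nat lookup_add power_add prod.distrib)
qed

definition mpoly_eval :: "('v \<Rightarrow> ('w, 'k::field) mpoly) \<Rightarrow> ('v, 'k) mpoly \<Rightarrow> ('w, 'k) mpoly" where
  "mpoly_eval \<phi> = extend_sum (\<lambda>m a. mpoly_const a * eval_mono \<phi> m)"

lemma mpoly_const_hom:
  "mpoly_const 0 = 0" "mpoly_const 1 = 1" "mpoly_const (a + b) = mpoly_const a + mpoly_const b"
  "mpoly_const (a * b) = mpoly_const a * mpoly_const b"
  by (simp_all add: mpoly_const_def single_add mult_single)

lemma mpoly_eval_simps:
  "mpoly_eval \<phi> 0 = 0"
  "mpoly_eval \<phi> (p + q) = mpoly_eval \<phi> p + mpoly_eval \<phi> q"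
  "mpoly_eval \<phi> (\<Sum>i\<in>A. g i) = (\<Sum>i\<in>A. mpoly_eval \<phi> (g i))"
  "mpoly_eval \<phi> (Poly_Mapping.single m a) = mpoly_const a * eval_mono \<phi> m"
  by (simp_all add: mpoly_eval_def extend_sum_add extend_sum_sum extend_sum_single mpoly_const_hom ring_distribs)

lemma mpoly_eval_diff: "mpoly_eval \<phi> (p - q) = mpoly_eval \<phi> p - mpoly_eval \<phi> q"
  using mpoly_eval_simps(2)[of \<phi> "p - q" q] by simp

lemma mpoly_eval_mult: "mpoly_eval \<phi> (p * q) = mpoly_eval \<phi> p * mpoly_eval \<phi> q"
proof -
  let ?lp = "Poly_Mapping.lookup p" and ?lq = "Poly_Mapping.lookup q"
  have "mpoly_eval \<phi> (p * q) =
      mpoly_eval \<phi> ((\<Sum>m\<in>Poly_Mapping.keys p. Poly_Mapping.single m (?lp m)) *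
                    (\<Sum>m\<in>Poly_Mapping.keys q. Poly_Mapping.single m (?lq m)))"
    by (simp flip: poly_mapping_sum_single)
  also have "\<dots> = (\<Sum>m\<in>Poly_Mapping.keys p. mpoly_eval \<phi> (Poly_Mapping.single m (?lp m))) *
                    (\<Sum>m\<in>Poly_Mapping.keys q. mpoly_eval \<phi> (Poly_Mapping.single m (?lq m)))"
    by (simp add: sum_product mult_single mpoly_eval_simps mpoly_const_hom eval_mono_add mult_ac)
  also have "\<dots> = mpoly_eval \<phi> p * mpoly_eval \<phi> q"
    by (simp flip: mpoly_eval_simps(3) poly_mapping_sum_single)
  finally show ?thesis .
qed

lemma mpoly_eval_const: "mpoly_eval \<phi> (mpoly_const a) = mpoly_const a"
  unfolding mpoly_const_def mpoly_eval_simps by (simp add: mpoly_const_def eval_mono_def)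

lemma mpoly_eval_one: "mpoly_eval \<phi> 1 = 1"
  using mpoly_eval_const[of \<phi> 1] by (simp add: mpoly_const_hom)

lemma mpoly_eval_var: "mpoly_eval \<phi> (mpoly_var v) = \<phi> v"
  by (simp add: mpoly_var_def mpoly_eval_simps mpoly_const_hom eval_mono_def)

lemma mpoly_eval_eval_mono:
  fixes \<phi> :: "'v \<Rightarrow> ('w, 'k::field) mpoly" and \<sigma> :: "'w \<Rightarrow> ('u, 'k) mpoly"
  shows "mpoly_eval \<sigma> (eval_mono \<phi> m) = eval_mono (\<lambda>v. mpoly_eval \<sigma> (\<phi> v)) m"
proof -
  have power: "mpoly_eval \<sigma> (p ^ k) = mpoly_eval \<sigma> p ^ k" for p k
    by (induction k) (simp_all add: mpoly_eval_one mpoly_eval_mult)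
  have "mpoly_eval \<sigma> (\<Prod>v\<in>A. f v) = (\<Prod>v\<in>A. mpoly_eval \<sigma> (f v))" for f :: "'v \<Rightarrow> ('w, 'k) mpoly" and A
    by (induction A rule: infinite_finite_induct) (simp_all add: mpoly_eval_one mpoly_eval_mult)
  then show ?thesis by (simp add: eval_mono_def power)
qed

lemma mpoly_eval_comp: "mpoly_eval \<sigma> (mpoly_eval \<phi> p) = mpoly_eval (\<lambda>v. mpoly_eval \<sigma> (\<phi> v)) p"
  by (simp add: mpoly_eval_def[of \<phi>] mpoly_eval_def[of "\<lambda>v. mpoly_eval \<sigma> (\<phi> v)"] extend_sum_def
      mpoly_eval_simps mpoly_eval_mult mpoly_eval_const mpoly_eval_eval_mono)

text \<open>The target is an integral domain. The linear order on its variables orders the monomials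
  compatibly with addition, which is what rules out zero divisors.\<close>

lemma primeideal_kernel_mpoly_eval:
  fixes \<phi> :: "'v \<Rightarrow> ('w::linorder, 'k::field) mpoly"
  shows "primeideal {p \<in> carrier (mpoly_ring V). mpoly_eval \<phi> p = 0} (mpoly_ring V)"
proof (rule primeidealI)
  show "ideal {p \<in> carrier (mpoly_ring V). mpoly_eval \<phi> p = 0} (mpoly_ring V)"
    by (rule ideal_mpoly_ringI) (auto simp: mpoly_eval_simps mpoly_eval_mult intro: carrier_closed)
  show "cring (mpoly_ring V :: ('v, 'k) mpoly ring)" by (rule mpoly_ring_cring)
  have "(1 :: ('v, 'k) mpoly) \<in> carrier (mpoly_ring V)" by (rule carrier_closed)
  then show "carrier (mpoly_ring V) \<noteq> {p \<in> carrier (mpoly_ring V). mpoly_eval \<phi> p = 0}"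
    using mpoly_eval_one[of \<phi>] by force
qed (auto simp: mpoly_eval_mult)

text \<open>The kernel for \<open>t = 0\<close> is the ideal of 2-minors of the generic \<open>2 \<times> n\<close> matrix, seen in the
  chart where the rows are \<open>(U\<^sub>1, \<dots>, U\<^sub>n)\<close> and its multiple by \<open>U\<^sub>0\<close>. Passing from \<open>t\<close> to \<open>t + 1\<close>
  sets \<open>U\<^sub>t = 0\<close>.\<close>

definition chart :: "nat \<Rightarrow> bvar \<Rightarrow> (nat, 'k::field) mpoly" where
  "chart t v = (case v of
       X i \<Rightarrow> if i \<ge> t then mpoly_var i else 0
     | Y i \<Rightarrow> if t = 0 then mpoly_var 0 * mpoly_var i else 0)"

lemma chart_Suc:
  "chart (Suc t) v = mpoly_eval (\<lambda>j. if j = t then 0 else mpoly_var j) (chart t v)"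
  by (cases v) (auto simp: chart_def mpoly_eval_var mpoly_eval_mult mpoly_eval_simps)

lemma mpoly_var_nonzero: "mpoly_var v \<noteq> 0"
  by (simp add: mpoly_var_def) (metis lookup_single_eq lookup_zero one_neq_zero)

definition chart_kernel :: "nat \<Rightarrow> nat \<Rightarrow> (bvar, 'k::field) mpoly set" where
  "chart_kernel n t = {p \<in> carrier (mpoly_ring (bvars n)). mpoly_eval (chart t) p = 0}"

text \<open>Each chart is the preceding one followed by a substitution, so the kernels increase. The
  \<open>n + 1\<close> strict steps end at \<open>t = n + 1\<close>, where all variables of the ring
  are sent to zero.\<close>

lemma chart_kernel_strict:
  assumes "n \<ge> 1" "t \<le> n"
  shows "chart_kernel n t \<subset> (chart_kernel n (Suc t) :: (bvar, 'k::field) mpoly set)"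
proof (rule psubsetI)
  have "mpoly_eval (chart (Suc t)) p = mpoly_eval (\<lambda>j. if j = t then 0 else mpoly_var j) (mpoly_eval (chart t) p)"
    for p :: "(bvar, 'k) mpoly"
    unfolding mpoly_eval_comp chart_Suc[symmetric] ..
  then show "chart_kernel n t \<subseteq> (chart_kernel n (Suc t) :: (bvar, 'k) mpoly set)"
    by (auto simp: chart_kernel_def mpoly_eval_simps)
  \<comment> \<open>A variable that survives in chart \<open>t\<close> and dies in the next: setting
    \<open>U\<^sub>0 = 0\<close> kills the second row, setting \<open>U\<^sub>t = 0\<close> kills
    \<open>X t\<close>.\<close>
  let ?v = "if t = 0 then Y 1 else X t"
  have "mpoly_var ?v \<in> carrier (mpoly_ring (bvars n) :: (bvar, 'k) mpoly ring)"
    using assms by (auto simp: mpoly_var_def bvars_def intro!: carrier_closed)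
  then have "mpoly_var ?v \<in> chart_kernel n (Suc t) - (chart_kernel n t :: (bvar, 'k) mpoly set)"
    by (auto simp: chart_kernel_def mpoly_eval_var chart_def mpoly_var_nonzero)
  then show "chart_kernel n t \<noteq> (chart_kernel n (Suc t) :: (bvar, 'k) mpoly set)" by blast
qed

lemma primeideal_chart_kernel: "primeideal (chart_kernel n t) (mpoly_ring (bvars n))"
  unfolding chart_kernel_def by (rule primeideal_kernel_mpoly_eval)

text \<open>For \<open>t = 0\<close> both products of a generator become
  \<open>U\<^sub>0 U\<^sub>i U\<^sub>j\<close>; in the later charts every \<open>Y\<close> is
  zero.\<close>

lemma binomial_edge_ideal_subset_chart_kernel: "binomial_edge_ideal n E \<subseteq> chart_kernel n t"
  unfolding binomial_edge_ideal_def
proof (rule ring.genideal_minimal[OF mpoly_ring_ring])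
  show "ideal (chart_kernel n t) (mpoly_ring (bvars n))"
    by (rule primeideal_mpoly_ringD(1)[OF primeideal_chart_kernel])
  show "{mpoly_var (X i) * mpoly_var (Y j) - mpoly_var (X j) * mpoly_var (Y i) | i j.
      i \<in> {1..n} \<and> j \<in> {1..n} \<and> i < j \<and> {i, j} \<in> E} \<subseteq> chart_kernel n t"
    using edge_gens_carrier[of n E]
    by (fastforce simp: chart_kernel_def mpoly_eval_diff mpoly_eval_mult mpoly_eval_var chart_def mult_ac)
qed

lemma krull_dim_cycle:
  assumes "n \<ge> 3"
    and "hilbert_series (bvars n) (binomial_edge_ideal n (cycle_edges n) :: (bvar, 'k::field) mpoly set)
      = fps_of_poly h / (1 - fps_X) ^ (n + 1)"
  shows "krull_dim (mpoly_ring (bvars n) Quot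
      (binomial_edge_ideal n (cycle_edges n) :: (bvar, 'k) mpoly set)) = enat (n + 1)"
proof (rule krull_dim_quot_eqI[OF ideal_binomial_edge_ideal])
  show "l \<le> n + 1"
    if "\<And>i. i \<le> l \<Longrightarrow> primeideal (P i) (mpoly_ring (bvars n))" "\<And>i. i < l \<Longrightarrow> P i \<subset> P (Suc i)"
      "binomial_edge_ideal n (cycle_edges n) \<subseteq> P 0" for l and P :: "nat \<Rightarrow> (bvar, 'k) mpoly set"
    by (rule prime_chain_length_le[OF assms(1) refl assms(2) that])
  show "chart_kernel n i \<subset> (chart_kernel n (Suc i) :: (bvar, 'k) mpoly set)" if "i < n + 1" for i
    using assms(1) that by (intro chart_kernel_strict) auto
qed (rule primeideal_chart_kernel binomial_edge_ideal_subset_chart_kernel)+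

text \<open>The Krull dimension fixes the exponent, and then the series fixes the numerator because
  \<open>1 - fps_X\<close> is a unit; hence the description is unique.\<close>

lemma graded_multiplicity_eqI:
  fixes I :: "('v, 'k::field) mpoly set"
  assumes "krull_dim (mpoly_ring V Quot I) = enat d"
    and "hilbert_series V I = fps_of_poly h / (1 - fps_X) ^ d"
  shows "graded_multiplicity V I = poly h 1"
  unfolding graded_multiplicity_def
proof (rule the_equality)
  fix e assume "\<exists>h d. krull_dim (mpoly_ring V Quot I) = enat d \<and>
    hilbert_series V I = fps_of_poly h / (1 - fps_X) ^ d \<and> e = poly h 1"
  then obtain h' where h': "hilbert_series V I = fps_of_poly h' / (1 - fps_X) ^ d" "e = poly h' 1"
    using assms(1) by auto
  have "fps_of_poly h = fps_of_poly h'"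
    using assms(2) h'(1) by (metis fps_div_one_minus_X_iff)
  then show "e = poly h 1" using h'(2) by (simp add: fps_of_poly_eq_iff)
qed (intro exI[of _ h] exI[of _ d] conjI assms refl)

theorem theorem3p10:
  fixes n :: nat and I :: "(bvar, 'k::field) mpoly set"
  assumes "n \<ge> 3"
    and "I = binomial_edge_ideal n (cycle_edges n)"
  shows "hilbert_series (bvars n) I =
           ((1 + fps_X) ^ (n - 1) - fps_X ^ 2 * (1 + fps_X) ^ (n - 1)
              + of_nat (n - 1) * fps_X ^ n + fps_X ^ (n + 1))
           / (1 - fps_X) ^ (n + 1)
         \<and> graded_multiplicity (bvars n) I = of_nat n"
proof
  \<comment> \<open>The numerator as an honest polynomial, since the multiplicity is its value at
    \<open>1\<close>.\<close>
  let ?t = "[:0, 1:] :: rat poly"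
  let ?h = "(1 + ?t) ^ (n - 1) - ?t ^ 2 * (1 + ?t) ^ (n - 1) + of_nat (n - 1) * ?t ^ n + ?t ^ (n + 1)"
  show hs: "hilbert_series (bvars n) I =
           ((1 + fps_X) ^ (n - 1) - fps_X ^ 2 * (1 + fps_X) ^ (n - 1)
              + of_nat (n - 1) * fps_X ^ n + fps_X ^ (n + 1))
           / (1 - fps_X) ^ (n + 1)"
    unfolding assms(2) hilbert_series_cycle[OF assms(1)]
    by (rule list_gf_cyc_count) (use assms(1) in simp)
  have of_nat: "fps_of_poly (of_nat k) = of_nat k" for k :: nat
    by (induction k) (simp_all add: fps_of_poly_add)
  have hs': "hilbert_series (bvars n) I = fps_of_poly ?h / (1 - fps_X) ^ (n + 1)"
    unfolding hs fps_of_poly_add fps_of_poly_diff fps_of_poly_mult fps_of_poly_power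
      fps_of_poly_fps_X fps_of_poly_1 of_nat ..
  have "krull_dim (mpoly_ring (bvars n) Quot I) = enat (n + 1)"
    using krull_dim_cycle[OF assms(1)] hs' unfolding assms(2) by blast
  then have "graded_multiplicity (bvars n) I = poly ?h 1"
    using hs' by (rule graded_multiplicity_eqI)
  \<comment> \<open>At \<open>1\<close> the two terms with \<open>2 ^ (n - 1)\<close> cancel and
    \<open>(n - 1) + 1\<close> remains.\<close>
  also have "\<dots> = of_nat n"
    using assms(1) by (simp add: of_nat_diff)
  finally show "graded_multiplicity (bvars n) I = of_nat n" .
qed

end
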